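(* Let $\ell$ be a prime and let $K/\mathbb{Q}$ be a Galois extension with $\mathrm{Gal}(K/\mathbb{Q})\simeq C_\ell\times C_\ell$. Then $a_{p^\ell}(K)\neq 0$ for every prime $p$.
   Context: For a number field $K$ with ring of integers $\mathcal{O}_K$, $a_n(K)$ denotes the number of nonzero ideals $\mathfrak{a}\subset\mathcal{O}_K$ with $[\mathcal{O}_K:\mathfrak{a}]=n$, i.e. the $n$-th coefficient of the Dedekind zeta function $\zeta_K(s)=\sum_{n\ge1}a_n(K)n^{-s}$. $C_\ell$ denotes the cyclic group of order $\ell$. *)

theory Defs
  imports
    "HOL-Algebra.Algebraic_Closure_Type"
    "HOL-Algebra.Embedded_Algebras"
    "HOL-Algebra.Elementary_Groups"
    "HOL-Algebra.Bij"
    "HOL-Algebra.QuotRing"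
begin

text \<open>
  Fields are subfields of an ambient type of class \<open>field_char_0\<close> (such as \<open>complex\<close>; the
  subfield may also be the whole type), and \<open>\<rat>\<close> is the prime field of that type.
\<close>

definition ring_on :: "'a::ring_1 set \<Rightarrow> 'a ring"
  where "ring_on S = ring_of_type_algebra\<lparr>carrier := S\<rparr>"

definition number_field :: "'a::field_char_0 set \<Rightarrow> bool"
  where "number_field K \<longleftrightarrow>
    subfield K ring_of_type_algebra \<and> ring.finite_dimension ring_of_type_algebra \<rat> K"

definition ring_of_integers :: "'a::field_char_0 set \<Rightarrow> 'a ring"
  where "ring_of_integers K = ring_on {x \<in> K. algebraic_int x}"

text \<open>
  As for \<^const>\<open>AutoGroup\<close>, automorphisms are extensional functions, so that each
  automorphism of \<open>L\<close> is represented by exactly one function on the ambient type.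
\<close>

definition galois_group :: "'a::field set \<Rightarrow> 'a set \<Rightarrow> ('a \<Rightarrow> 'a) monoid"
  where "galois_group L F = (BijGroup L)
    \<lparr>carrier := {\<sigma> \<in> Bij L. \<sigma> \<in> ring_hom (ring_on L) (ring_on L) \<and> (\<forall>x\<in>F. \<sigma> x = x)}\<rparr>"

text \<open>A finite extension is Galois if \<open>F\<close> is the fixed field of the group of \<open>F\<close>-automorphisms.\<close>

definition finite_galois_extension :: "'a::field set \<Rightarrow> 'a set \<Rightarrow> bool"
  where "finite_galois_extension L F \<longleftrightarrow>
    subfield L ring_of_type_algebra \<and> subfield F ring_of_type_algebra \<and> F \<subseteq> L \<and>
    ring.finite_dimension ring_of_type_algebra F L \<and>
    {x \<in> L. \<forall>\<sigma> \<in> carrier (galois_group L F). \<sigma> x = x} = F"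

text \<open>
  The number of nonzero ideals of index \<open>n\<close>, for \<open>n \<ge> 1\<close>; the index is the number of additive
  cosets. For \<open>n = 0\<close> the value carries no meaning, as \<^const>\<open>card\<close> is 0 on infinite sets.
\<close>

definition dedekind_coeff :: "'a::field_char_0 set \<Rightarrow> nat \<Rightarrow> nat"
  where "dedekind_coeff K n =
    card {I. ideal I (ring_of_integers K) \<and> I \<noteq> {0} \<and>
             card (a_rcosets\<^bsub>ring_of_integers K\<^esub> I) = n}"

end

theory Submission
  imports Defs "Jordan_Normal_Form.Char_Poly" "HOL-Algebra.Sylow"
    "HOL-Algebra.Multiplicative_Group" "HOL-Number_Theory.Cong"
begin

text \<open>
  Let \<open>O\<close> be the ring of integers, \<open>G\<close> the Galois group and \<open>M\<close> a prime ideal of \<open>O\<close> containing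
  \<open>p\<close>. For each \<open>x \<in> O\<close> there is a \<open>\<sigma> \<in> G\<close> which acts on the orbit of \<open>x\<close> as the \<open>p\<close>-th power modulo
  \<open>M\<close>; since \<open>G\<close> has exponent \<open>l\<close>, iterating gives \<open>x ^ (p ^ l) \<equiv> x\<close>. Hence \<open>O / M\<close> is a finite field
  whose degree over the prime field divides the prime \<open>l\<close>, so it has \<open>p\<close> or \<open>p ^ l\<close> elements.
  If some \<open>M\<close> has index \<open>p ^ l\<close>, it is the desired ideal. Otherwise every such \<open>M\<close> has index \<open>p\<close>,
  and one descends from \<open>O\<close>: below an ideal \<open>I\<close> of \<open>p\<close>-power index choose a maximal one \<open>J\<close> among
  those between \<open>p I\<close> and \<open>I\<close>; then \<open>I / J\<close> is simple, so it is isomorphic to some \<open>O / M\<close> and has \<open>p\<close>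
  elements. After \<open>l\<close> steps the index is \<open>p ^ l\<close>.
\<close>

section \<open>Sums and products of algebraic integers\<close>

text \<open>What the group contributes is its exponent: a Frobenius of order dividing
  \<open>l\<close> keeps the residue degree at 1 or \<open>l\<close>. In a cyclic extension of
  degree \<open>l ^ 2\<close> a prime \<open>p\<close> can be inert, and then every ideal of
  \<open>p\<close>-power index has a power of \<open>p ^ (l ^ 2)\<close> as index, which misses
  \<open>p ^ l\<close>. The automorphism comes from a polynomial. The product of all
  \<open>Y - \<sigma> a\<close> is invariant under \<open>G\<close>, so its coefficients come from
  \<int>, where the \<open>p\<close>-th power is trivial modulo \<open>p\<close>. Hence
  \<open>a ^ p\<close> is again a root modulo \<open>M\<close>, and primality selects a
  \<open>\<sigma>\<close>. For a single number this settles one step only, and the next conjugate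
  could demand another \<open>\<sigma>\<close>; this is why the argument runs in a polynomial ring
  over \<open>O\<close>. That \<open>\<sigma>\<close> varies with \<open>x\<close> does no harm,
  since every \<open>\<sigma>\<close> has order dividing \<open>l\<close>. Two further facts carry
  the descent: \<open>O / p O\<close> is finite because elements independent modulo \<open>p\<close>
  are independent over \<rat>, and \<open>1 / p\<close> is not integral, so \<open>p I\<close> is a
  proper part of each ideal \<open>I\<close> that occurs.\<close>

lemma algebraic_int_if_integer_eigenvector:
  fixes z :: "'a::field_char_0" and w :: "nat \<Rightarrow> 'a" and c :: "nat \<Rightarrow> nat \<Rightarrow> int"
  assumes w: "i0 < n" "w i0 \<noteq> 0"
    and eq: "\<And>i. i < n \<Longrightarrow> z * w i = (\<Sum>j<n. of_int (c i j) * w j)"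
  shows "algebraic_int z"
proof -
  define A where "A = mat n n (\<lambda>(i,j). c i j)"
  define B where "B = map_mat (of_int :: int \<Rightarrow> 'a) A"
  have A: "A \<in> carrier_mat n n" by (simp add: A_def)
  hence B: "B \<in> carrier_mat n n" by (simp add: B_def)
  \<comment> \<open>The characteristic polynomial of \<open>A\<close> is monic over \<int> and maps
    to that of \<open>B\<close>, so every eigenvalue of \<open>B\<close> is an algebraic
    integer.\<close>
  have "eigenvector B (vec n w) z"
  proof -
    have "vec n w \<noteq> 0\<^sub>v n"
      using w by (metis index_vec index_zero_vec(1))
    moreover have "B *\<^sub>v vec n w = z \<cdot>\<^sub>v vec n w"
      by (rule eq_vecI)
        (auto simp: B_def A_def scalar_prod_def eq atLeast0LessThan)
    ultimately show ?thesis using B by (simp add: eigenvector_def)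
  qed
  hence "eigenvalue B z" by (auto simp: eigenvalue_def)
  hence "poly (char_poly B) z = 0"
    using eigenvalue_root_char_poly[OF B] by simp
  moreover have "char_poly B = map_poly of_int (char_poly A)"
    unfolding B_def by (rule of_int_hom.char_poly_hom[OF A])
  moreover have "lead_coeff (char_poly A) = 1"
    using degree_monic_char_poly[OF A] by auto
  ultimately show ?thesis
    unfolding algebraic_int_altdef_ipoly by metis
qed

text \<open>The monic equation solved for its leading power. The bound \<open>n > 0\<close>
  guarantees later that the monomial 1 is among the generators, which makes the eigenvector
  nonzero.\<close>

lemma algebraic_int_power_reduction:
  fixes x :: "'a::field_char_0"
  assumes "algebraic_int x"
  obtains n :: nat and c :: "nat \<Rightarrow> int" where "n > 0" "x ^ n = (\<Sum>i<n. of_int (c i) * x ^ i)"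
proof -
  obtain P :: "int poly" where P: "poly (map_poly of_int P) x = 0" "lead_coeff P = 1"
    using assms by (auto simp: algebraic_int_altdef_ipoly)
  define n where "n = degree P"
  have "n > 0"
  proof (rule ccontr)
    assume "\<not> n > 0"
    then obtain a where "P = [:a:]" by (auto simp: n_def elim: degree_eq_zeroE)
    with P show False by simp
  qed
  moreover have "x ^ n = (\<Sum>i<n. of_int (- coeff P i) * x ^ i)"
  proof -
    have "0 = (\<Sum>i\<le>n. of_int (coeff P i) * x ^ i)"
      using P(1) by (simp add: poly_altdef n_def)
    also have "\<dots> = (\<Sum>i<n. of_int (coeff P i) * x ^ i) + x ^ n"
      using P(2) by (simp add: n_def lessThan_Suc_atMost[symmetric])
    finally show ?thesis by (simp add: sum_negf add_eq_0_iff)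
  qed
  ultimately show thesis by (rule that)
qed

text \<open>The monomials \<open>x ^ i * y ^ j\<close> below the two degrees span a \<open>\<int>\<close>-module stable under
  \<open>x\<close> and \<open>y\<close>; the integer matrix of multiplication by an element has that element as eigenvalue.\<close>

lemma algebraic_int_plus_times:
  fixes x y :: "'a::field_char_0"
  assumes "algebraic_int x" "algebraic_int y"
  shows "algebraic_int (x + y)" "algebraic_int (x * y)"
proof -
  obtain m a where m: "m > 0" "x ^ m = (\<Sum>i<m. of_int (a i) * x ^ i)"
    by (rule algebraic_int_power_reduction[OF assms(1)])
  obtain n b where n: "n > 0" "y ^ n = (\<Sum>i<n. of_int (b i) * y ^ i)"
    by (rule algebraic_int_power_reduction[OF assms(2)])
  \<comment> \<open>The exponent pairs are flattened into one index by division with remainder,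
    because matrix rows are numbered by naturals.\<close>
  define w where "w k = x ^ (k mod m) * y ^ (k div m)" for k
  have w: "w (i + j * m) = x ^ i * y ^ j" if "i < m" for i j
    using that m(1) by (simp add: w_def)
  have lt: "i + j * m < m * n" if "i < m" "j < n" for i j
  proof -
    have "i + j * m < (j + 1) * m" using that by simp
    also have "\<dots> \<le> n * m" using that by (intro mult_right_mono) auto
    finally show ?thesis by (simp add: mult.commute)
  qed
  define V where "V = {z. \<exists>c :: nat \<Rightarrow> int. z = (\<Sum>k<m*n. of_int (c k) * w k)}"
  have V0: "0 \<in> V" unfolding V_def by (intro CollectI exI[of _ "\<lambda>_. 0"]) simp
  have Vadd: "u + v \<in> V" if "u \<in> V" "v \<in> V" for u v
  proof -
    from that obtain c d where "u = (\<Sum>k<m*n. of_int (c k) * w k)" "v = (\<Sum>k<m*n. of_int (d k) * w k)"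
      by (auto simp: V_def)
    thus ?thesis unfolding V_def
      by (intro CollectI exI[of _ "\<lambda>k. c k + d k"]) (simp add: sum.distrib algebra_simps)
  qed
  have Vint: "of_int e * u \<in> V" if "u \<in> V" for u e
  proof -
    from that obtain c where "u = (\<Sum>k<m*n. of_int (c k) * w k)"
      by (auto simp: V_def)
    thus ?thesis unfolding V_def
      by (intro CollectI exI[of _ "\<lambda>k. e * c k"]) (simp add: sum_distrib_left algebra_simps)
  qed
  have Vsum: "(\<Sum>i\<in>I. f i) \<in> V" if "\<And>i. i \<in> I \<Longrightarrow> f i \<in> V" for I :: "nat set" and f
    using that by (induction I rule: infinite_finite_induct) (auto simp: V0 Vadd)
  have Vw: "w k \<in> V" if "k < m * n" for k
    unfolding V_def using that
    by (intro CollectI exI[of _ "\<lambda>j. if j = k then 1 else 0"])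
      (simp add: if_distrib[of of_int] if_distrib[of "\<lambda>t. t * _"] sum.delta cong: if_cong)
  have Vmon: "x ^ i * y ^ j \<in> V" if "i < m" "j < n" for i j
    using Vw[OF lt[OF that]] w[OF that(1)] by simp
  \<comment> \<open>Multiplication by \<open>x\<close> or \<open>y\<close> raises an exponent by at
    most one, so only the boundary values \<open>i = m\<close> and \<open>j = n\<close> have to be
    rewritten by the monic relations.\<close>
  have Vmon_x: "x ^ i * y ^ j \<in> V" if "i \<le> m" "j < n" for i j
  proof (cases "i = m")
    case True
    have "x ^ i * y ^ j = (\<Sum>i<m. of_int (a i) * (x ^ i * y ^ j))"
      unfolding True m(2) by (subst sum_distrib_right) (simp add: mult.assoc)
    also have "\<dots> \<in> V" using that by (intro Vsum Vint Vmon) auto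
    finally show ?thesis .
  qed (use Vmon that in auto)
  have Vmon_xy: "x ^ i * y ^ j \<in> V" if "i \<le> m" "j \<le> n" for i j
  proof (cases "j = n")
    case True
    have "x ^ i * y ^ j = (\<Sum>j<n. of_int (b j) * (x ^ i * y ^ j))"
      unfolding True n(2) by (subst sum_distrib_left) (simp add: mult.left_commute)
    also have "\<dots> \<in> V" using that by (intro Vsum Vint Vmon_x) auto
    finally show ?thesis .
  qed (use Vmon_x that in auto)
  have xw: "x * w k \<in> V" "x * y * w k \<in> V" "y * w k \<in> V" if "k < m * n" for k
  proof -
    have 1: "k mod m < m" "k div m < n"
      using that m(1) by (auto simp: less_mult_imp_div_less mult.commute)
    have 2: "x * w k = x ^ Suc (k mod m) * y ^ (k div m)"
      "y * w k = x ^ (k mod m) * y ^ Suc (k div m)"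
      "x * y * w k = x ^ Suc (k mod m) * y ^ Suc (k div m)"
      by (simp_all add: w_def algebra_simps)
    show "x * w k \<in> V" "x * y * w k \<in> V" "y * w k \<in> V"
      unfolding 2 using 1 by (auto intro!: Vmon_xy simp del: power_Suc)
  qed
  have *: "algebraic_int z" if "\<And>k. k < m * n \<Longrightarrow> z * w k \<in> V" for z
  proof -
    have "\<forall>k. \<exists>c :: nat \<Rightarrow> int. k < m * n \<longrightarrow> z * w k = (\<Sum>j<m*n. of_int (c j) * w j)"
      using that by (auto simp: V_def)
    then obtain c :: "nat \<Rightarrow> nat \<Rightarrow> int"
      where "\<And>k. k < m * n \<Longrightarrow> z * w k = (\<Sum>j<m*n. of_int (c k j) * w j)"
      by metis
    moreover have "0 < m * n" "w 0 \<noteq> 0" using m n by (auto simp: w_def)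
    ultimately show ?thesis by (rule algebraic_int_if_integer_eigenvector[rotated 2])
  qed
  show "algebraic_int (x + y)"
    by (rule *) (auto simp: distrib_right intro!: Vadd xw)
  show "algebraic_int (x * y)"
    by (rule *) (auto intro!: xw)
qed

section \<open>Ideals and polynomials over a subring\<close>

text \<open>Subrings are plain subsets of a type, so that type-class polynomials remain available
  and \<open>polys\<close> can be iterated to give polynomials in two variables. The record-based
  notions of the theorem are reached through \<open>ring_on\<close>.\<close>

definition is_subring :: "'a::comm_ring_1 set \<Rightarrow> bool"
  where "is_subring S \<longleftrightarrow> 1 \<in> S \<and> (\<forall>x\<in>S. \<forall>y\<in>S. x - y \<in> S \<and> x * y \<in> S)"

definition is_ideal :: "'a::comm_ring_1 set \<Rightarrow> 'a set \<Rightarrow> bool"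
  where "is_ideal S I \<longleftrightarrow> I \<subseteq> S \<and> 0 \<in> I \<and> (\<forall>x\<in>I. \<forall>y\<in>I. x + y \<in> I) \<and> (\<forall>r\<in>S. \<forall>x\<in>I. r * x \<in> I)"

definition is_prime_ideal :: "'a::comm_ring_1 set \<Rightarrow> 'a set \<Rightarrow> bool"
  where "is_prime_ideal S I \<longleftrightarrow> is_ideal S I \<and> 1 \<notin> I \<and> (\<forall>x\<in>S. \<forall>y\<in>S. x * y \<in> I \<longrightarrow> x \<in> I \<or> y \<in> I)"

definition hom_on :: "'a::comm_ring_1 set \<Rightarrow> ('a \<Rightarrow> 'b::comm_ring_1) \<Rightarrow> bool"
  where "hom_on S h \<longleftrightarrow> h 0 = 0 \<and> h 1 = 1 \<and>
    (\<forall>x\<in>S. \<forall>y\<in>S. h (x + y) = h x + h y \<and> h (x * y) = h x * h y)"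

definition polys :: "'a::comm_ring_1 set \<Rightarrow> 'a poly set"
  where "polys S = {f. \<forall>i. coeff f i \<in> S}"

lemma
  assumes "is_subring S"
  shows subring_one: "1 \<in> S" and subring_zero: "0 \<in> S"
    and subring_diff: "x \<in> S \<Longrightarrow> y \<in> S \<Longrightarrow> x - y \<in> S"
    and subring_mult: "x \<in> S \<Longrightarrow> y \<in> S \<Longrightarrow> x * y \<in> S"
    and subring_uminus: "x \<in> S \<Longrightarrow> - x \<in> S"
    and subring_add: "x \<in> S \<Longrightarrow> y \<in> S \<Longrightarrow> x + y \<in> S"
proof -
  show 1: "1 \<in> S" and d: "x \<in> S \<Longrightarrow> y \<in> S \<Longrightarrow> x - y \<in> S"
    and "x \<in> S \<Longrightarrow> y \<in> S \<Longrightarrow> x * y \<in> S" for x y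
    using assms by (auto simp: is_subring_def)
  show z: "0 \<in> S" using d[OF 1 1] by simp
  show m: "- x \<in> S" if "x \<in> S" for x using d[OF z that] by simp
  show "x + y \<in> S" if "x \<in> S" "y \<in> S" for x y using d[OF that(1) m[OF that(2)]] by simp
qed

lemma subring_of_nat: "is_subring S \<Longrightarrow> of_nat n \<in> S"
  by (induction n) (auto intro: subring_zero subring_one subring_add)

lemma subring_of_int: "is_subring S \<Longrightarrow> of_int n \<in> S"
  by (cases n) (auto intro: subring_of_nat subring_uminus simp del: of_nat_Suc)

lemma subring_power: "is_subring S \<Longrightarrow> x \<in> S \<Longrightarrow> x ^ n \<in> S"
  by (induction n) (auto intro: subring_one subring_mult)

lemma subring_sum: "is_subring S \<Longrightarrow> (\<And>i. i \<in> I \<Longrightarrow> f i \<in> S) \<Longrightarrow> sum f I \<in> S"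
  by (induction I rule: infinite_finite_induct) (auto intro: subring_zero subring_add)

lemma subring_prod: "is_subring S \<Longrightarrow> (\<And>i. i \<in> I \<Longrightarrow> f i \<in> S) \<Longrightarrow> prod f I \<in> S"
  by (induction I rule: infinite_finite_induct) (auto intro: subring_one subring_mult)

lemma
  assumes "is_ideal S I"
  shows ideal_zero: "0 \<in> I" and ideal_add: "x \<in> I \<Longrightarrow> y \<in> I \<Longrightarrow> x + y \<in> I"
    and ideal_mult: "r \<in> S \<Longrightarrow> x \<in> I \<Longrightarrow> r * x \<in> I"
    and ideal_subset: "I \<subseteq> S"
  using assms by (auto simp: is_ideal_def)

lemma
  assumes "is_subring S" "is_ideal S I"
  shows ideal_uminus: "x \<in> I \<Longrightarrow> - x \<in> I" and ideal_diff: "x \<in> I \<Longrightarrow> y \<in> I \<Longrightarrow> x - y \<in> I"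
proof -
  show m: "- x \<in> I" if "x \<in> I" for x
    using ideal_mult[OF assms(2), of "-1" x] that subring_uminus[OF assms(1)] subring_one[OF assms(1)]
    by simp
  show "x - y \<in> I" if "x \<in> I" "y \<in> I" for x y
    using ideal_add[OF assms(2) that(1) m[OF that(2)]] by simp
qed

lemma ideal_sum: "is_ideal S I \<Longrightarrow> (\<And>i. i \<in> A \<Longrightarrow> f i \<in> I) \<Longrightarrow> sum f A \<in> I"
  by (induction A rule: infinite_finite_induct) (auto intro: ideal_zero ideal_add)

lemma ideal_mult_right: "is_ideal S I \<Longrightarrow> r \<in> S \<Longrightarrow> x \<in> I \<Longrightarrow> x * r \<in> I"
  by (metis ideal_mult mult.commute)

lemma is_subring_polys: "is_subring S \<Longrightarrow> is_subring (polys S)"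
  unfolding is_subring_def[of "polys S"]
  by (auto simp: polys_def coeff_mult coeff_1 intro!: subring_sum subring_mult subring_diff
      subring_one subring_zero)

lemma is_ideal_polys: "is_subring S \<Longrightarrow> is_ideal S I \<Longrightarrow> is_ideal (polys S) (polys I)"
  unfolding is_ideal_def[of "polys S"]
  by (auto simp: polys_def coeff_mult intro!: ideal_sum ideal_mult ideal_add ideal_zero
      dest: ideal_subset)

text \<open>Gauss's lemma: compare the lowest coefficients outside the prime ideal.\<close>

lemma is_prime_ideal_polys:
  assumes S: "is_subring S" and P: "is_prime_ideal S I"
  shows "is_prime_ideal (polys S) (polys I)"
proof -
  have I: "is_ideal S I" using P by (simp add: is_prime_ideal_def)
  have "f \<in> polys I \<or> g \<in> polys I" if fg: "f \<in> polys S" "g \<in> polys S" "f * g \<in> polys I" for f g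
  proof (rule ccontr)
    assume "\<not> ?thesis"
    hence ex: "\<exists>i. coeff f i \<notin> I" "\<exists>j. coeff g j \<notin> I"
      unfolding polys_def by blast+
    define i where "i = (LEAST i. coeff f i \<notin> I)"
    define j where "j = (LEAST j. coeff g j \<notin> I)"
    have i: "coeff f i \<notin> I" "\<And>k. k < i \<Longrightarrow> coeff f k \<in> I"
      unfolding i_def by (rule LeastI_ex[OF ex(1)], drule not_less_Least, blast)
    have j: "coeff g j \<notin> I" "\<And>k. k < j \<Longrightarrow> coeff g k \<in> I"
      unfolding j_def by (rule LeastI_ex[OF ex(2)], drule not_less_Least, blast)
    have "coeff (f * g) (i + j) =
        coeff f i * coeff g j + (\<Sum>k\<in>{..i+j}-{i}. coeff f k * coeff g (i + j - k))"
      unfolding coeff_mult by (subst sum.remove[of _ i]) auto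
    moreover have "(\<Sum>k\<in>{..i+j}-{i}. coeff f k * coeff g (i + j - k)) \<in> I"
    proof (rule ideal_sum[OF I])
      fix k assume k: "k \<in> {..i+j} - {i}"
      show "coeff f k * coeff g (i + j - k) \<in> I"
      proof (cases "k < i")
        case True
        thus ?thesis using i(2) fg by (auto intro: ideal_mult_right[OF I] simp: polys_def)
      next
        case False
        hence "i + j - k < j" using k by auto
        thus ?thesis using j(2) fg by (auto intro: ideal_mult[OF I] simp: polys_def)
      qed
    qed
    moreover have "coeff (f * g) (i + j) \<in> I" using fg by (auto simp: polys_def)
    ultimately have "coeff f i * coeff g j \<in> I"
      using ideal_diff[OF S I] by (metis add_diff_cancel_right')
    moreover have "coeff f i \<in> S" "coeff g j \<in> S" using fg by (auto simp: polys_def)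
    ultimately show False using P i(1) j(1) by (auto simp: is_prime_ideal_def)
  qed
  moreover have "1 \<notin> polys I"
    using P by (auto simp: polys_def is_prime_ideal_def intro!: exI[of _ 0])
  ultimately show ?thesis using is_ideal_polys[OF S I] by (simp add: is_prime_ideal_def)
qed

lemma prime_ideal_prod:
  assumes "is_subring S" "is_prime_ideal S I" "finite A" "\<And>i. i \<in> A \<Longrightarrow> f i \<in> S" "prod f A \<in> I"
  shows "\<exists>i\<in>A. f i \<in> I"
  using assms(3,4,5)
proof (induction A rule: finite_induct)
  case (insert a A)
  have "prod f A \<in> S" using insert.prems by (auto intro!: subring_prod[OF assms(1)])
  with insert assms(2) show ?case by (auto simp: is_prime_ideal_def)
qed (use assms(2) in \<open>auto simp: is_prime_ideal_def\<close>)

section \<open>Homomorphisms on a subring and their action on coefficients\<close>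

lemma
  assumes "hom_on S h"
  shows hom_on_0: "h 0 = 0" and hom_on_1: "h 1 = 1"
    and hom_on_add: "x \<in> S \<Longrightarrow> y \<in> S \<Longrightarrow> h (x + y) = h x + h y"
    and hom_on_mult: "x \<in> S \<Longrightarrow> y \<in> S \<Longrightarrow> h (x * y) = h x * h y"
  using assms by (auto simp: hom_on_def)

lemma hom_on_uminus:
  assumes "is_subring S" "hom_on S h" "x \<in> S"
  shows "h (- x) = - h x"
  using hom_on_add[OF assms(2,3) subring_uminus[OF assms(1,3)]] hom_on_0[OF assms(2)]
  by (simp add: minus_unique)

lemma hom_on_sum:
  assumes "is_subring S" "hom_on S h" "\<And>i. i \<in> A \<Longrightarrow> f i \<in> S"
  shows "h (sum f A) = (\<Sum>i\<in>A. h (f i))"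
  using assms(3)
  by (induction A rule: infinite_finite_induct)
    (auto simp: hom_on_0[OF assms(2)] hom_on_add[OF assms(2)] subring_sum[OF assms(1)])

lemma hom_on_prod:
  assumes "is_subring S" "hom_on S h" "\<And>i. i \<in> A \<Longrightarrow> f i \<in> S"
  shows "h (prod f A) = (\<Prod>i\<in>A. h (f i))"
  using assms(3)
  by (induction A rule: infinite_finite_induct)
    (auto simp: hom_on_1[OF assms(2)] hom_on_mult[OF assms(2)] subring_prod[OF assms(1)])

lemma hom_on_map_poly:
  assumes S: "is_subring S" and h: "hom_on S h"
  shows "hom_on (polys S) (map_poly h)"
proof -
  note [simp] = hom_on_0[OF h] hom_on_1[OF h] coeff_map_poly
  have "map_poly h (x + y) = map_poly h x + map_poly h y" if "x \<in> polys S" "y \<in> polys S" for x y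
    using that by (intro poly_eqI) (auto simp: polys_def hom_on_add[OF h])
  moreover have "map_poly h (x * y) = map_poly h x * map_poly h y"
    if "x \<in> polys S" "y \<in> polys S" for x y
    using that
    by (intro poly_eqI)
      (auto simp: polys_def coeff_mult hom_on_sum[OF S h] subring_mult[OF S] hom_on_mult[OF h])
  moreover have "map_poly h 1 = 1" by (intro poly_eqI) (auto simp: coeff_1)
  ultimately show ?thesis by (auto simp: hom_on_def)
qed

text \<open>The inner binomial coefficients are divisible by \<open>p\<close>, so the
  \<open>p\<close>-th power is additive modulo any ideal containing \<open>p\<close>. Its extension
  to sums is applied with \<open>polys S\<close> in place of \<open>S\<close>.\<close>

lemma prime_power_add_in_ideal:
  assumes S: "is_subring S" and I: "is_ideal S I" and p: "Factorial_Ring.prime (p::nat)" "of_nat p \<in> I"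
    and xy: "x \<in> S" "y \<in> S"
  shows "(x + y) ^ p - (x ^ p + y ^ p) \<in> I"
proof -
  have p0: "p > 0" using p(1) prime_gt_0_nat by blast
  have eq: "{..p} = insert 0 (insert p {0<..<p})" by auto
  have "(x + y) ^ p = (\<Sum>k\<le>p. of_nat (p choose k) * x ^ k * y ^ (p - k))"
    by (rule binomial_ring)
  also have "\<dots> = y ^ p + x ^ p + (\<Sum>k\<in>{0<..<p}. of_nat (p choose k) * x ^ k * y ^ (p - k))"
    unfolding eq using p0 by (simp add: algebra_simps)
  finally have 1: "(x + y) ^ p - (x ^ p + y ^ p) = (\<Sum>k\<in>{0<..<p}. of_nat (p choose k) * x ^ k * y ^ (p - k))"
    by simp
  show ?thesis unfolding 1
  proof (rule ideal_sum[OF I])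
    fix k assume k: "k \<in> {0<..<p}"
    hence "p dvd (p choose k)" using p(1) by (intro dvd_choose_prime) auto
    then obtain d where d: "p choose k = p * d" by blast
    have "of_nat (p choose k) * x ^ k * y ^ (p - k) = of_nat p * (of_nat d * x ^ k * y ^ (p - k))"
      by (simp add: d algebra_simps)
    also have "\<dots> \<in> I"
      by (intro ideal_mult_right[OF I] subring_mult[OF S] subring_of_nat[OF S] subring_power[OF S] xy p(2))
    finally show "of_nat (p choose k) * x ^ k * y ^ (p - k) \<in> I" .
  qed
qed

lemma prime_power_sum_in_ideal:
  assumes S: "is_subring S" and I: "is_ideal S I" and p: "Factorial_Ring.prime (p::nat)" "of_nat p \<in> I"
    and f: "\<And>i. i \<in> A \<Longrightarrow> f i \<in> S" and A: "finite A"
  shows "sum f A ^ p - (\<Sum>i\<in>A. f i ^ p) \<in> I"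
  using A f
proof (induction A rule: finite_induct)
  case empty
  have "p > 0" using p(1) prime_gt_0_nat by blast
  thus ?case using ideal_zero[OF I] by (simp add: power_0_left)
next
  case (insert a A)
  have "(f a + sum f A) ^ p - (f a ^ p + sum f A ^ p) \<in> I"
    using insert.prems by (intro prime_power_add_in_ideal[OF S I p] subring_sum[OF S]) auto
  from ideal_add[OF I this insert.IH] insert.prems insert.hyps show ?case
    by (simp add: algebra_simps)
qed

lemma power_diff_in_ideal:
  assumes S: "is_subring S" and I: "is_ideal S I" and "x \<in> S" "y \<in> S" "x - y \<in> I"
  shows "x ^ n - y ^ n \<in> I"
proof (induction n)
  case (Suc n)
  have "x * (x ^ n - y ^ n) + (x - y) * y ^ n \<in> I"
    using assms Suc by (intro ideal_add[OF I] ideal_mult[OF I] ideal_mult_right[OF I] subring_power[OF S])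
  thus ?case by (simp add: algebra_simps)
qed (use ideal_zero[OF I] in simp)

section \<open>Lifting the Frobenius\<close>

lemma pcompose_monom_monom:
  fixes c :: "'a::comm_ring_1"
  shows "pcompose (monom c i) (monom 1 n) = monom c (i * n)"
proof -
  have "pcompose ([:0, 1:] ^ i) (monom 1 n) = (monom (1::'a) n) ^ i"
    by (induction i) (simp_all add: pcompose_mult pcompose_pCons)
  thus ?thesis
    by (simp add: monom_altdef[of c i] pcompose_smult monom_power smult_monom mult.commute)
qed

text \<open>The bound \<open>N\<close> may exceed the degree, so that a polynomial and its image
  under an automorphism can be summed over the same range and subtracted termwise.\<close>

lemma pcompose_monom_eq_sum:
  fixes f :: "'a::comm_ring_1 poly"
  assumes "degree f \<le> N"
  shows "pcompose f (monom 1 n) = (\<Sum>i\<le>N. monom (coeff f i) (i * n))"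
proof -
  have "pcompose f (monom 1 n) = pcompose (\<Sum>i\<le>N. monom (coeff f i) i) (monom 1 n)"
    using poly_as_sum_of_monoms'[OF assms] by simp
  thus ?thesis by (simp add: pcompose_sum pcompose_monom_monom)
qed

lemma monom_in_polys: "0 \<in> S \<Longrightarrow> c \<in> S \<Longrightarrow> monom c i \<in> polys S"
  by (simp add: polys_def)

lemma of_nat_in_polys: "0 \<in> S \<Longrightarrow> of_nat n \<in> S \<Longrightarrow> of_nat n \<in> polys S"
  by (simp add: polys_def of_nat_poly coeff_pCons split: nat.split)

lemma poly_power_prime_in_ideal:
  assumes S: "is_subring S" and I: "is_ideal S I" and p: "Factorial_Ring.prime (p::nat)" "of_nat p \<in> I"
    and f: "f \<in> polys S" "degree f \<le> N"
  shows "f ^ p - (\<Sum>i\<le>N. monom (coeff f i ^ p) (i * p)) \<in> polys I"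
proof -
  have "(\<Sum>i\<le>N. monom (coeff f i) i) ^ p - (\<Sum>i\<le>N. monom (coeff f i) i ^ p) \<in> polys I"
    using f(1) ideal_zero[OF I] p(2)
    by (intro prime_power_sum_in_ideal[OF is_subring_polys[OF S] is_ideal_polys[OF S I] p(1)]
        monom_in_polys of_nat_in_polys subring_zero[OF S]) (auto simp: polys_def)
  thus ?thesis using poly_as_sum_of_monoms'[OF f(2)] by (simp add: monom_power mult.commute)
qed

text \<open>Fermat's little theorem: additivity of the \<open>p\<close>-th power gives an induction
  over the naturals, and a general integer is first replaced by its residue modulo
  \<open>p\<close>.\<close>

lemma int_power_prime_diff:
  assumes S: "is_subring S" and I: "is_ideal S I" and p: "Factorial_Ring.prime (p::nat)" "of_nat p \<in> I"
    and c: "c \<in> \<int>"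
  shows "c ^ p - c \<in> I"
proof -
  obtain k :: int where k: "c = of_int k" using c by (auto elim: Ints_cases)
  have nat: "of_nat n ^ p - of_nat n \<in> I" for n
  proof (induction n)
    case 0
    have "p > 0" using p(1) prime_gt_0_nat by blast
    thus ?case using ideal_zero[OF I] by (simp add: power_0_left)
  next
    case (Suc n)
    have "(of_nat n + 1) ^ p - (of_nat n ^ p + 1 ^ p) \<in> I"
      by (rule prime_power_add_in_ideal[OF S I p subring_of_nat[OF S] subring_one[OF S]])
    from ideal_add[OF I this Suc] show ?case by (simp add: algebra_simps)
  qed
  define n where "n = nat (k mod int p)"
  have "k = int n + int p * (k div int p)"
    using p(1) prime_gt_0_nat[of p] by (simp add: n_def)
  hence "c = of_int (int n + int p * (k div int p))" unfolding k by (rule arg_cong)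
  hence eq: "c - of_nat n = of_nat p * of_int (k div int p)" by simp
  have cn: "c - of_nat n \<in> I"
    unfolding eq by (intro ideal_mult_right[OF I] p(2) subring_of_int[OF S])
  have "c ^ p - of_nat n ^ p \<in> I"
    unfolding k by (rule power_diff_in_ideal[OF S I])
      (use cn k in \<open>auto intro: subring_of_int[OF S] subring_of_nat[OF S]\<close>)
  from ideal_diff[OF S I ideal_add[OF I this nat[of n]] cn] show ?thesis by simp
qed

text \<open>Automorphisms are extensional functions, so the group product is not literal
  composition; \<open>m\<close> stands for it and agrees with composition on \<open>S\<close>. The
  assumption \<open>bij\<close> allows products over \<open>G\<close> to be reindexed, and
  \<open>fixed\<close> combines the fixed field \<rat> with the integral closedness of
  \<int>.\<close>

locale galois_ring =
  fixes S :: "'a::field_char_0 set" and G :: "('a \<Rightarrow> 'a) set"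
    and m :: "('a \<Rightarrow> 'a) \<Rightarrow> ('a \<Rightarrow> 'a) \<Rightarrow> ('a \<Rightarrow> 'a)" and e :: "'a \<Rightarrow> 'a"
  assumes subring: "is_subring S"
    and finite_G: "finite G"
    and hom: "\<sigma> \<in> G \<Longrightarrow> hom_on S \<sigma>"
    and maps: "\<sigma> \<in> G \<Longrightarrow> x \<in> S \<Longrightarrow> \<sigma> x \<in> S"
    and bij: "\<sigma> \<in> G \<Longrightarrow> bij_betw (m \<sigma>) G G"
    and mult: "\<sigma> \<in> G \<Longrightarrow> \<tau> \<in> G \<Longrightarrow> x \<in> S \<Longrightarrow> m \<sigma> \<tau> x = \<sigma> (\<tau> x)"
    and one: "e \<in> G" "x \<in> S \<Longrightarrow> e x = x"
    and fixed: "x \<in> S \<Longrightarrow> (\<And>\<sigma>. \<sigma> \<in> G \<Longrightarrow> \<sigma> x = x) \<Longrightarrow> x \<in> \<int>"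
begin

text \<open>With \<open>X\<close> the variable of \<open>a\<close> and \<open>Y\<close> that of
  \<open>F\<close>, invariance puts \<open>F\<close> into \<int>[X][Y]. Raising
  \<open>F(a) = 0\<close> to the \<open>p\<close>-th power and replacing \<open>p\<close>-th powers
  of coefficients by the substitution \<open>X \<mapsto> X ^ p\<close> shows that the product of all
  \<open>a ^ p - \<psi> (A \<sigma>)\<close> lies in the extended ideal. That ideal is prime by
  Gauss's lemma, so one factor lies in it.\<close>

lemma frobenius_lift_poly:
  assumes M: "is_prime_ideal S M" and p: "Factorial_Ring.prime (p::nat)" "of_nat p \<in> M"
    and a: "a \<in> polys S"
  shows "\<exists>\<sigma>\<in>G. \<forall>i. coeff a i ^ p - \<sigma> (coeff a i) \<in> M"
proof -
  define A where "A \<sigma> = map_poly \<sigma> a" for \<sigma> :: "'a \<Rightarrow> 'a"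
  define F where "F = (\<Prod>\<sigma>\<in>G. [:- A \<sigma>, 1:])"
  define \<psi> where "\<psi> f = pcompose f (monom 1 p)" for f :: "'a poly"
  have I: "is_ideal S M" using M by (simp add: is_prime_ideal_def)
  note PS = is_subring_polys[OF subring] and PI = is_ideal_polys[OF subring I]
  have p0: "p > 0" using p(1) by (rule prime_gt_0_nat)
  have zS: "0 \<in> S" by (rule subring_zero[OF subring])
  have pP: "of_nat p \<in> polys M" by (rule of_nat_in_polys[OF ideal_zero[OF I] p(2)])
  have h0: "\<sigma> 0 = 0" if "\<sigma> \<in> G" for \<sigma> using hom_on_0[OF hom[OF that]] .
  have aS: "coeff a i \<in> S" for i using a by (simp add: polys_def)
  have AS: "A \<sigma> \<in> polys S" if "\<sigma> \<in> G" for \<sigma>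
    using that aS by (auto simp: A_def polys_def coeff_map_poly h0 maps)
  have FS: "[:- A \<sigma>, 1:] \<in> polys (polys S)" if "\<sigma> \<in> G" for \<sigma>
    using subring_uminus[OF PS AS[OF that]] subring_one[OF PS] subring_zero[OF PS]
    by (auto simp: polys_def[of "polys S"] coeff_pCons split: nat.split)
  have FS': "F \<in> polys (polys S)"
    unfolding F_def by (intro subring_prod[OF is_subring_polys[OF PS]] FS)
  \<comment> \<open>Left multiplication by \<open>\<rho>\<close> permutes \<open>G\<close>, hence it
    permutes the linear factors of \<open>F\<close>.\<close>
  have F_fixed: "map_poly (map_poly \<rho>) F = F" if \<rho>: "\<rho> \<in> G" for \<rho>
  proof -
    note H1 = hom_on_map_poly[OF subring hom[OF \<rho>]]
    note H2 = hom_on_map_poly[OF PS H1]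
    have "map_poly (map_poly \<rho>) F = (\<Prod>\<sigma>\<in>G. map_poly (map_poly \<rho>) [:- A \<sigma>, 1:])"
      unfolding F_def by (intro hom_on_prod[OF is_subring_polys[OF PS] H2] FS)
    also have "\<dots> = (\<Prod>\<sigma>\<in>G. [:- A (m \<rho> \<sigma>), 1:])"
    proof (rule prod.cong[OF refl])
      fix \<sigma> assume \<sigma>: "\<sigma> \<in> G"
      hence m\<sigma>: "m \<rho> \<sigma> \<in> G" using bij[OF \<rho>] by (auto simp: bij_betw_def)
      have "map_poly \<rho> (A \<sigma>) = A (m \<rho> \<sigma>)"
        unfolding A_def by (rule poly_eqI) (simp add: coeff_map_poly h0 \<rho> \<sigma> m\<sigma> mult aS)
      thus "map_poly (map_poly \<rho>) [:- A \<sigma>, 1:] = [:- A (m \<rho> \<sigma>), 1:]"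
        using hom_on_uminus[OF PS H1 AS[OF \<sigma>]] hom_on_1[OF H1] by (simp add: map_poly_pCons)
    qed
    also have "\<dots> = F"
      unfolding F_def by (rule prod.reindex_bij_betw[OF bij[OF \<rho>]])
    finally show ?thesis .
  qed
  have int: "coeff (coeff F i) j \<in> \<int>" for i j
  proof (rule fixed)
    show "coeff (coeff F i) j \<in> S" using FS' by (simp add: polys_def)
    show "\<rho> (coeff (coeff F i) j) = coeff (coeff F i) j" if "\<rho> \<in> G" for \<rho>
      using F_fixed[OF that] h0[OF that] by (metis coeff_map_poly map_poly_0)
  qed
  \<comment> \<open>On integer polynomials the \<open>p\<close>-th power agrees with
    \<open>\<psi>\<close> modulo \<open>M\<close>: it is additive there, and Fermat's theorem
    removes the power from each coefficient.\<close>
  have coeff_cong: "c ^ p - \<psi> c \<in> polys M" if "c \<in> polys S" "\<And>j. coeff c j \<in> \<int>" for c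
  proof -
    have "c ^ p - (\<Sum>i\<le>degree c. monom (coeff c i ^ p) (i * p)) \<in> polys M"
      by (rule poly_power_prime_in_ideal[OF subring I p that(1) order_refl])
    moreover have "(\<Sum>i\<le>degree c. monom (coeff c i ^ p - coeff c i) (i * p)) \<in> polys M"
      by (intro ideal_sum[OF PI] monom_in_polys ideal_zero[OF I]
          int_power_prime_diff[OF subring I p] that)
    hence "(\<Sum>i\<le>degree c. monom (coeff c i ^ p) (i * p)) - \<psi> c \<in> polys M"
      unfolding \<psi>_def pcompose_monom_eq_sum[OF order_refl]
      by (simp add: sum_subtractf[symmetric] diff_monom)
    ultimately show ?thesis using ideal_add[OF PI] by fastforce
  qed
  have psi_hom: "hom_on UNIV \<psi>"
    by (simp add: hom_on_def \<psi>_def pcompose_add pcompose_mult pcompose_1)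
  have UNIV_sub: "is_subring (UNIV :: 'a poly set)" by (simp add: is_subring_def)
  have polys_UNIV: "polys UNIV = (UNIV :: 'a poly poly set)" by (simp add: polys_def)
  note UNIV_sub2 = is_subring_polys[OF UNIV_sub, unfolded polys_UNIV]
  note psi_hom2 = hom_on_map_poly[OF UNIV_sub psi_hom, unfolded polys_UNIV]
  \<comment> \<open>As \<open>\<psi>\<close> is a ring endomorphism, applying it to the coefficients
    of \<open>F\<close> applies it to the roots.\<close>
  have "(\<Prod>\<sigma>\<in>G. a ^ p - \<psi> (A \<sigma>)) = poly (map_poly \<psi> F) (a ^ p)"
  proof -
    have "map_poly \<psi> F = (\<Prod>\<sigma>\<in>G. map_poly \<psi> [:- A \<sigma>, 1:])"
      unfolding F_def by (rule hom_on_prod[OF UNIV_sub2 psi_hom2]) simp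
    also have "\<dots> = (\<Prod>\<sigma>\<in>G. [:- \<psi> (A \<sigma>), 1:])"
      using hom_on_uminus[OF UNIV_sub psi_hom] hom_on_1[OF psi_hom] hom_on_0[OF psi_hom]
      by (simp add: map_poly_pCons)
    finally show ?thesis by (simp add: poly_prod)
  qed
  also have "\<dots> = (\<Sum>i\<le>degree F. \<psi> (coeff F i) * (a ^ p) ^ i)"
  proof -
    have "map_poly \<psi> F = map_poly \<psi> (\<Sum>i\<le>degree F. monom (coeff F i) i)"
      by (simp add: poly_as_sum_of_monoms)
    also have "\<dots> = (\<Sum>i\<le>degree F. monom (\<psi> (coeff F i)) i)"
      by (subst hom_on_sum[OF UNIV_sub2 psi_hom2]) (simp_all add: map_poly_monom hom_on_0[OF psi_hom])
    finally show ?thesis by (simp add: poly_sum poly_monom)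
  qed
  also have "\<dots> \<in> polys M"
  proof -
    have cS: "coeff F i \<in> polys S" for i using FS' by (simp add: polys_def)
    have "(\<Sum>i\<le>degree F. coeff F i * a ^ i) = poly F a" by (simp add: poly_altdef)
    also have "\<dots> = (\<Prod>\<sigma>\<in>G. a - A \<sigma>)" by (simp add: F_def poly_prod)
    \<comment> \<open>The factor of the identity makes \<open>a\<close> a root of
      \<open>F\<close>.\<close>
    also have "a - A e = 0"
      unfolding A_def by (rule poly_eqI) (simp add: coeff_map_poly h0 one aS)
    hence "(\<Prod>\<sigma>\<in>G. a - A \<sigma>) = 0" using finite_G one(1) by auto
    finally have "(\<Sum>i\<le>degree F. coeff F i * a ^ i) ^ p = 0"
      using p0 by (simp add: power_0_left)
    moreover have "(\<Sum>i\<le>degree F. coeff F i * a ^ i) ^ p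
        - (\<Sum>i\<le>degree F. (coeff F i * a ^ i) ^ p) \<in> polys M"
      by (intro prime_power_sum_in_ideal[OF PS PI p(1) pP] subring_mult[OF PS] subring_power[OF PS] a cS)
        simp
    ultimately have "0 - (\<Sum>i\<le>degree F. (coeff F i * a ^ i) ^ p) \<in> polys M"
      by (simp only:)
    hence "- (0 - (\<Sum>i\<le>degree F. (coeff F i * a ^ i) ^ p)) \<in> polys M"
      by (rule ideal_uminus[OF PS PI])
    hence "(\<Sum>i\<le>degree F. (coeff F i * a ^ i) ^ p) \<in> polys M" by simp
    moreover have "(\<Sum>i\<le>degree F. (coeff F i ^ p - \<psi> (coeff F i)) * (a ^ i) ^ p) \<in> polys M"
      by (intro ideal_sum[OF PI] ideal_mult_right[OF PI] coeff_cong int cS subring_power[OF PS] a)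
    ultimately have "(\<Sum>i\<le>degree F. (coeff F i * a ^ i) ^ p)
        - (\<Sum>i\<le>degree F. (coeff F i ^ p - \<psi> (coeff F i)) * (a ^ i) ^ p) \<in> polys M"
      by (rule ideal_diff[OF PS PI])
    thus ?thesis
      by (simp add: sum_subtractf[symmetric] algebra_simps power_mult_distrib flip: power_mult)
  qed
  finally obtain \<sigma> where \<sigma>: "\<sigma> \<in> G" "a ^ p - \<psi> (A \<sigma>) \<in> polys M"
  proof -
    assume *: "(\<Prod>\<sigma>\<in>G. a ^ p - \<psi> (A \<sigma>)) \<in> polys M"
      and that: "\<And>\<sigma>. \<sigma> \<in> G \<Longrightarrow> a ^ p - \<psi> (A \<sigma>) \<in> polys M \<Longrightarrow> thesis"
    have "\<psi> (A \<sigma>) \<in> polys S" if "\<sigma> \<in> G" for \<sigma>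
      unfolding \<psi>_def pcompose_monom_eq_sum[OF order_refl]
      using AS[OF that] zS by (intro subring_sum[OF PS] monom_in_polys) (auto simp: polys_def)
    hence "\<exists>\<sigma>\<in>G. a ^ p - \<psi> (A \<sigma>) \<in> polys M"
      by (intro prime_ideal_prod[OF PS is_prime_ideal_polys[OF subring M] finite_G _ *]
          subring_diff[OF PS] subring_power[OF PS] a)
    with that show thesis by blast
  qed
  \<comment> \<open>Both sides are, modulo \<open>M\<close>, polynomials in \<open>X ^ p\<close>, so
    the coefficient at \<open>j * p\<close> isolates the index \<open>j\<close>.\<close>
  have "coeff a j ^ p - \<sigma> (coeff a j) \<in> M" for j
  proof (cases "j \<le> degree a")
    case True
    have dA: "degree (A \<sigma>) \<le> degree a" unfolding A_def by (rule degree_map_poly_le)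
    have "a ^ p - (\<Sum>i\<le>degree a. monom (coeff a i ^ p) (i * p)) \<in> polys M"
      by (rule poly_power_prime_in_ideal[OF subring I p a order_refl])
    from ideal_diff[OF PS PI \<sigma>(2) this]
    have "(\<Sum>i\<le>degree a. monom (coeff a i ^ p - \<sigma> (coeff a i)) (i * p)) \<in> polys M"
      unfolding \<psi>_def pcompose_monom_eq_sum[OF dA]
      by (simp add: sum_subtractf[symmetric] diff_monom[symmetric] A_def coeff_map_poly h0 \<sigma>(1))
    hence "coeff (\<Sum>i\<le>degree a. monom (coeff a i ^ p - \<sigma> (coeff a i)) (i * p)) (j * p) \<in> M"
      by (simp add: polys_def)
    also have "coeff (\<Sum>i\<le>degree a. monom (coeff a i ^ p - \<sigma> (coeff a i)) (i * p)) (j * p) =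
        (\<Sum>i\<le>degree a. if i = j then coeff a i ^ p - \<sigma> (coeff a i) else 0)"
      using p0 by (auto simp: coeff_sum coeff_monom intro!: sum.cong)
    also have "\<dots> = coeff a j ^ p - \<sigma> (coeff a j)" using True by simp
    finally show ?thesis .
  next
    case False
    hence "coeff a j = 0" by (simp add: coeff_eq_0)
    thus ?thesis using p0 ideal_zero[OF I] h0[OF \<sigma>(1)] by (simp add: power_0_left)
  qed
  with \<sigma>(1) show ?thesis by blast
qed

text \<open>Applying \<open>frobenius_lift_poly\<close> to a polynomial whose coefficients are the whole orbit of
  \<open>x\<close> yields one automorphism that can be iterated.\<close>

lemma frobenius_lift_orbit:
  assumes M: "is_prime_ideal S M" and p: "Factorial_Ring.prime (p::nat)" "of_nat p \<in> M"
    and x: "x \<in> S"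
  shows "\<exists>\<sigma>\<in>G. \<forall>n. x ^ (p ^ n) - (\<sigma> ^^ n) x \<in> M"
proof -
  have I: "is_ideal S M" using M by (simp add: is_prime_ideal_def)
  \<comment> \<open>An injective numbering of \<open>G\<close> gives each conjugate of
    \<open>x\<close> its own exponent, so that no two of them are added up in one
    coefficient.\<close>
  obtain ix :: "('a \<Rightarrow> 'a) \<Rightarrow> nat" where ix: "inj_on ix G"
    using finite_imp_inj_to_nat_seg[OF finite_G] by blast
  define a where "a = (\<Sum>\<tau>\<in>G. monom (\<tau> x) (ix \<tau>))"
  have "a \<in> polys S"
    unfolding a_def using x subring_zero[OF subring]
    by (intro subring_sum[OF is_subring_polys[OF subring]] monom_in_polys) (auto intro: maps)
  from frobenius_lift_poly[OF M p this] obtain \<sigma>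
    where \<sigma>: "\<sigma> \<in> G" "\<And>i. coeff a i ^ p - \<sigma> (coeff a i) \<in> M" by blast
  have coeff_a: "coeff a (ix \<tau>) = \<tau> x" if "\<tau> \<in> G" for \<tau>
  proof -
    have "coeff a (ix \<tau>) = (\<Sum>\<rho>\<in>G. if \<rho> = \<tau> then \<rho> x else 0)"
      unfolding a_def coeff_sum using ix that by (intro sum.cong) (auto simp: coeff_monom inj_on_def)
    thus ?thesis using finite_G that by simp
  qed
  have step: "(\<tau> x) ^ p - \<sigma> (\<tau> x) \<in> M" if "\<tau> \<in> G" for \<tau>
    using \<sigma>(2)[of "ix \<tau>"] coeff_a[OF that] by simp
  \<comment> \<open>Every iterate of \<open>\<sigma>\<close> on \<open>x\<close> is again a
    conjugate \<open>\<tau> x\<close> with \<open>\<tau> \<in> G\<close>, so \<open>step\<close>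
    applies to it with the same \<open>\<sigma>\<close>.\<close>
  have orbit: "\<exists>\<tau>\<in>G. (\<sigma> ^^ n) x = \<tau> x" for n
  proof (induction n)
    case 0 show ?case using one(1) one(2)[OF x] by (intro bexI[of _ e]) simp_all
  next
    case (Suc n)
    then obtain \<tau> where "\<tau> \<in> G" "(\<sigma> ^^ n) x = \<tau> x" by blast
    moreover have "m \<sigma> \<tau> \<in> G" using bij[OF \<sigma>(1)] \<open>\<tau> \<in> G\<close> by (auto simp: bij_betw_def)
    ultimately show ?case
      using mult[OF \<sigma>(1) \<open>\<tau> \<in> G\<close> x] by (intro bexI[of _ "m \<sigma> \<tau>"]) simp_all
  qed
  have "x ^ (p ^ n) - (\<sigma> ^^ n) x \<in> M" for n
  proof (induction n)
    case 0 show ?case using ideal_zero[OF I] by simp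
  next
    case (Suc n)
    obtain \<tau> where \<tau>: "\<tau> \<in> G" "(\<sigma> ^^ n) x = \<tau> x" using orbit by blast
    have "(x ^ (p ^ n)) ^ p - (\<tau> x) ^ p \<in> M"
      using Suc \<tau>(2)
      by (intro power_diff_in_ideal[OF subring I] subring_power[OF subring] x maps[OF \<tau>(1) x]) simp
    from ideal_add[OF I this step[OF \<tau>(1)]] show ?case
      using \<tau>(2) by (simp add: power_mult[symmetric] mult.commute)
  qed
  with \<sigma>(1) show ?thesis by blast
qed

end

section \<open>Ideals of finite index\<close>

definition add_coset :: "'a::comm_ring_1 set \<Rightarrow> 'a set \<Rightarrow> 'a \<Rightarrow> 'a set"
  where "add_coset S I x = {y \<in> S. y - x \<in> I}"

text \<open>A finite transversal is used instead of a cardinality: it carries finiteness with it,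
  and it also makes sense for an ideal \<open>I\<close> in the place of \<open>S\<close>, as needed
  for the factors of a chain of ideals.\<close>

definition has_index :: "'a::comm_ring_1 set \<Rightarrow> 'a set \<Rightarrow> nat \<Rightarrow> bool"
  where "has_index S I n \<longleftrightarrow>
    (\<exists>D\<subseteq>S. finite D \<and> card D = n \<and> (\<forall>x\<in>S. \<exists>d\<in>D. x - d \<in> I) \<and>
      (\<forall>x\<in>S. \<forall>c\<in>D. \<forall>d\<in>D. x - c \<in> I \<longrightarrow> x - d \<in> I \<longrightarrow> c = d))"

lemma has_indexE:
  assumes "has_index S I n"
  obtains D where "D \<subseteq> S" "finite D" "card D = n" "\<And>x. x \<in> S \<Longrightarrow> \<exists>d\<in>D. x - d \<in> I"
    "\<And>x c d. x \<in> S \<Longrightarrow> c \<in> D \<Longrightarrow> d \<in> D \<Longrightarrow> x - c \<in> I \<Longrightarrow> x - d \<in> I \<Longrightarrow> c = d"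
proof -
  obtain D where "D \<subseteq> S" "finite D" "card D = n" "\<forall>x\<in>S. \<exists>d\<in>D. x - d \<in> I"
    "\<forall>x\<in>S. \<forall>c\<in>D. \<forall>d\<in>D. x - c \<in> I \<longrightarrow> x - d \<in> I \<longrightarrow> c = d"
    using assms unfolding has_index_def by blast
  thus thesis by (intro that[of D]) blast+
qed

lemma has_indexI:
  assumes "D \<subseteq> S" "finite D" "card D = n" "\<And>x. x \<in> S \<Longrightarrow> \<exists>d\<in>D. x - d \<in> I"
    "\<And>x c d. x \<in> S \<Longrightarrow> c \<in> D \<Longrightarrow> d \<in> D \<Longrightarrow> x - c \<in> I \<Longrightarrow> x - d \<in> I \<Longrightarrow> c = d"
  shows "has_index S I n"
  unfolding has_index_def using assms by (intro exI[of _ D] conjI ballI impI) auto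

lemma add_coset_eq_iff:
  assumes S: "is_subring S" and I: "is_ideal S I" and x: "x \<in> S" and y: "y \<in> S"
  shows "add_coset S I x = add_coset S I y \<longleftrightarrow> x - y \<in> I"
proof
  assume "add_coset S I x = add_coset S I y"
  moreover have "x \<in> add_coset S I x" using x ideal_zero[OF I] by (simp add: add_coset_def)
  ultimately show "x - y \<in> I" by (simp add: add_coset_def)
next
  assume xy: "x - y \<in> I"
  have "z - x \<in> I \<longleftrightarrow> z - y \<in> I" for z
    using ideal_add[OF I _ xy, of "z - x"] ideal_diff[OF S I _ xy, of "z - y"]
    by (auto simp: algebra_simps)
  thus "add_coset S I x = add_coset S I y" by (simp add: add_coset_def)
qed

lemma card_add_cosets:
  assumes S: "is_subring S" and I: "is_ideal S I" and n: "has_index S I n"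
  shows "finite (add_coset S I ` S)" "card (add_coset S I ` S) = n"
proof -
  obtain D where D: "D \<subseteq> S" "finite D" "card D = n" "\<And>x. x \<in> S \<Longrightarrow> \<exists>d\<in>D. x - d \<in> I"
    "\<And>x c d. x \<in> S \<Longrightarrow> c \<in> D \<Longrightarrow> d \<in> D \<Longrightarrow> x - c \<in> I \<Longrightarrow> x - d \<in> I \<Longrightarrow> c = d"
    using has_indexE[OF n] by metis
  have inj: "inj_on (add_coset S I) D"
  proof (rule inj_onI)
    fix x y assume xy: "x \<in> D" "y \<in> D" "add_coset S I x = add_coset S I y"
    hence "x - y \<in> I" using add_coset_eq_iff[OF S I] D(1) by blast
    moreover have "x - x \<in> I" using ideal_zero[OF I] by simp
    ultimately show "x = y" using D(5)[of x x y] D(1) xy add_coset_eq_iff[OF S I] by blast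
  qed
  have "add_coset S I ` S = add_coset S I ` D"
  proof (intro equalityI subsetI)
    fix Q assume "Q \<in> add_coset S I ` S"
    then obtain x where x: "x \<in> S" "Q = add_coset S I x" by blast
    then obtain d where "d \<in> D" "x - d \<in> I" using D(4)[of x] by blast
    moreover from this have "Q = add_coset S I d"
      using x D(1) add_coset_eq_iff[OF S I] by blast
    ultimately show "Q \<in> add_coset S I ` D" by blast
  qed (use D(1) in blast)
  thus "finite (add_coset S I ` S)" "card (add_coset S I ` S) = n"
    using D(2,3) card_image[OF inj] by auto
qed

lemma has_index_card:
  assumes S: "is_subring S" and I: "is_ideal S I" and fin: "finite (add_coset S I ` S)"
  shows "has_index S I (card (add_coset S I ` S))"
proof -
  obtain D where D: "D \<subseteq> S" "inj_on (add_coset S I) D" "add_coset S I ` S = add_coset S I ` D"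
    using subset_image_inj[THEN iffD1, OF subset_refl] by metis
  have "finite D" using fin finite_image_iff[OF D(2)] D(3) by simp
  moreover have "card D = card (add_coset S I ` S)" using card_image[OF D(2)] D(3) by simp
  ultimately show ?thesis
  proof (intro has_indexI[OF D(1)])
    fix x assume x: "x \<in> S"
    then obtain d where "d \<in> D" "add_coset S I x = add_coset S I d" using D(3) by blast
    thus "\<exists>d\<in>D. x - d \<in> I" using x D(1) add_coset_eq_iff[OF S I] by blast
  next
    fix x c d assume "x \<in> S" "c \<in> D" "d \<in> D" "x - c \<in> I" "x - d \<in> I"
    hence "add_coset S I c = add_coset S I d"
      using D(1) add_coset_eq_iff[OF S I, of x] by blast
    with D(2) show "c = d" using \<open>c \<in> D\<close> \<open>d \<in> D\<close> by (rule inj_onD)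
  qed
qed

text \<open>The sums \<open>d + c\<close> of representatives for \<open>S / I\<close> and
  \<open>I / J\<close> form a transversal of \<open>S / J\<close>.\<close>

lemma has_index_tower:
  assumes S: "is_subring S" and I: "is_ideal S I" and J: "is_ideal S J" "J \<subseteq> I"
    and n: "has_index S I n" and k: "has_index I J k"
  shows "has_index S J (n * k)"
proof -
  obtain D where D: "D \<subseteq> S" "finite D" "card D = n" "\<And>x. x \<in> S \<Longrightarrow> \<exists>d\<in>D. x - d \<in> I"
    "\<And>x c d. x \<in> S \<Longrightarrow> c \<in> D \<Longrightarrow> d \<in> D \<Longrightarrow> x - c \<in> I \<Longrightarrow> x - d \<in> I \<Longrightarrow> c = d"
    using has_indexE[OF n] by metis
  obtain C where C: "C \<subseteq> I" "finite C" "card C = k" "\<And>x. x \<in> I \<Longrightarrow> \<exists>c\<in>C. x - c \<in> J"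
    "\<And>x c d. x \<in> I \<Longrightarrow> c \<in> C \<Longrightarrow> d \<in> C \<Longrightarrow> x - c \<in> J \<Longrightarrow> x - d \<in> J \<Longrightarrow> c = d"
    using has_indexE[OF k] by metis
  have IS: "I \<subseteq> S" using I by (rule ideal_subset)
  \<comment> \<open>Since \<open>J \<subseteq> I\<close>, comparison modulo \<open>I\<close>
    determines \<open>d\<close>; comparison of \<open>x - d\<close> modulo \<open>J\<close> then
    determines \<open>c\<close>.\<close>
  have uniq: "d = d' \<and> c = c'"
    if "d \<in> D" "d' \<in> D" "c \<in> C" "c' \<in> C" "x \<in> S" "x - (d + c) \<in> J" "x - (d' + c') \<in> J" for d d' c c' x
  proof -
    have 1: "x - d \<in> I"
      using ideal_add[OF I, of "x - (d + c)" c] that C(1) J(2) by (auto simp: algebra_simps)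
    have 2: "x - d' \<in> I"
      using ideal_add[OF I, of "x - (d' + c')" c'] that C(1) J(2) by (auto simp: algebra_simps)
    have "d = d'" using D(5) that 1 2 by blast
    moreover from this have "c = c'"
      using C(5)[OF 1 that(3,4)] that by (auto simp: diff_diff_eq)
    ultimately show ?thesis by simp
  qed
  define E where "E = (\<lambda>(d, c). d + c) ` (D \<times> C)"
  have "inj_on (\<lambda>(d, c). d + c) (D \<times> C)"
  proof (rule inj_onI, clarify)
    fix d c d' c' assume *: "d \<in> D" "c \<in> C" "d' \<in> D" "c' \<in> C" "d + c = d' + c'"
    show "d = d' \<and> c = c'"
      by (rule uniq[of _ _ _ _ "d + c"])
        (use * D(1) C(1) IS ideal_zero[OF J(1)] in \<open>auto intro: subring_add[OF S]\<close>)
  qed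
  hence "card E = n * k"
    unfolding E_def by (simp add: card_image card_cartesian_product D(3) C(3))
  moreover have "finite E" unfolding E_def using D(2) C(2) by simp
  moreover have "E \<subseteq> S" unfolding E_def using D(1) C(1) IS by (auto intro!: subring_add[OF S])
  moreover have "\<exists>e\<in>E. x - e \<in> J" if x: "x \<in> S" for x
  proof -
    obtain d where d: "d \<in> D" "x - d \<in> I" using D(4)[OF x] by blast
    obtain c where c: "c \<in> C" "x - d - c \<in> J" using C(4)[OF d(2)] by blast
    have "d + c \<in> E" "x - (d + c) \<in> J" using d c by (auto simp: E_def diff_diff_eq)
    thus ?thesis by blast
  qed
  moreover have "a = b"
    if x: "x \<in> S" and ab: "a \<in> E" "b \<in> E" and "x - a \<in> J" "x - b \<in> J" for x a b
  proof -
    obtain d c where dc: "d \<in> D" "c \<in> C" "a = d + c" using ab(1) by (auto simp: E_def)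
    obtain d' c' where dc': "d' \<in> D" "c' \<in> C" "b = d' + c'" using ab(2) by (auto simp: E_def)
    show ?thesis using uniq[of d d' c c' x] dc dc' that by simp
  qed
  ultimately show ?thesis by (intro has_indexI[of E])
qed

lemma has_index_self: "is_subring S \<Longrightarrow> has_index S S 1"
  by (rule has_indexI[of "{0}"]) (auto intro: subring_zero)

lemma is_ideal_self: "is_subring S \<Longrightarrow> is_ideal S S"
  by (auto simp: is_ideal_def intro: subring_zero subring_add subring_mult)

lemma is_ideal_multiples:
  assumes I: "is_ideal S I" and r: "r \<in> S"
  shows "is_ideal S ((*) r ` I)"
  unfolding is_ideal_def
proof (intro conjI ballI)
  show "(*) r ` I \<subseteq> S" using ideal_mult[OF I r] ideal_subset[OF I] by blast
  show "0 \<in> (*) r ` I" using ideal_zero[OF I] by (intro image_eqI[of _ _ 0]) auto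
  show "x + y \<in> (*) r ` I" if "x \<in> (*) r ` I" "y \<in> (*) r ` I" for x y
  proof -
    from that obtain u v where "u \<in> I" "v \<in> I" "x = r * u" "y = r * v" by blast
    thus ?thesis using ideal_add[OF I] by (intro image_eqI[of _ _ "u + v"]) (auto simp: distrib_left)
  qed
  show "s * x \<in> (*) r ` I" if "s \<in> S" "x \<in> (*) r ` I" for s x
  proof -
    from that obtain u where "u \<in> I" "x = r * u" by blast
    thus ?thesis using ideal_mult[OF I that(1)]
      by (intro image_eqI[of _ _ "s * u"]) (auto simp: mult.left_commute)
  qed
qed

text \<open>If \<open>J\<close> is maximal below \<open>I\<close>, the simple module \<open>I / J\<close> is isomorphic to \<open>S / M\<close>
  for its annihilator \<open>M\<close>.\<close>

lemma maximal_subideal_quotient: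
  assumes S: "is_subring S" and I: "is_ideal S I" and J: "is_ideal S J" "J \<subset> I"
    and max: "\<And>N. is_ideal S N \<Longrightarrow> J \<subseteq> N \<Longrightarrow> N \<subseteq> I \<Longrightarrow> N = J \<or> N = I"
    and y: "y \<in> I" "y \<notin> J"
  defines "M \<equiv> {x \<in> S. x * y \<in> J}"
  shows "is_prime_ideal S M" "has_index S M n \<Longrightarrow> has_index I J n"
proof -
  have IS: "I \<subseteq> S" using I by (rule ideal_subset)
  \<comment> \<open>Each \<open>z\<close> in \<open>I\<close> outside \<open>J\<close> generates
    \<open>I\<close> modulo \<open>J\<close>: the ideal \<open>N = J + S z\<close> lies between them
    and differs from \<open>J\<close>.\<close>
  have gen: "\<exists>r\<in>S. w - r * z \<in> J" if z: "z \<in> I" "z \<notin> J" and w: "w \<in> I" for z w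
  proof -
    define N where "N = {u \<in> I. \<exists>r\<in>S. u - r * z \<in> J}"
    have "is_ideal S N"
      unfolding is_ideal_def
    proof (intro conjI ballI)
      show "N \<subseteq> S" using IS by (auto simp: N_def)
      show "0 \<in> N" using ideal_zero[OF I] ideal_zero[OF J(1)] subring_zero[OF S]
        by (auto simp: N_def intro!: bexI[of _ 0])
    next
      fix u v assume "u \<in> N" "v \<in> N"
      then obtain r s where rs: "u \<in> I" "v \<in> I" "r \<in> S" "s \<in> S" "u - r * z \<in> J" "v - s * z \<in> J"
        by (auto simp: N_def)
      have "u + v - (r + s) * z \<in> J"
        using ideal_add[OF J(1) rs(5,6)] by (simp add: algebra_simps)
      thus "u + v \<in> N" using rs ideal_add[OF I] subring_add[OF S] by (auto simp: N_def)
    next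
      fix t u assume t: "t \<in> S" and "u \<in> N"
      then obtain r where r: "u \<in> I" "r \<in> S" "u - r * z \<in> J"
        by (auto simp: N_def)
      have "t * u - (t * r) * z \<in> J"
        using ideal_mult[OF J(1) t r(3)] by (simp add: algebra_simps)
      thus "t * u \<in> N" using r t ideal_mult[OF I] subring_mult[OF S] by (auto simp: N_def)
    qed
    moreover have "J \<subseteq> N"
      using J(2) subring_zero[OF S] by (auto simp: N_def intro!: bexI[of _ 0])
    moreover have "N \<subseteq> I" by (auto simp: N_def)
    moreover have "z \<in> N"
      using z(1) subring_one[OF S] ideal_zero[OF J(1)] by (auto simp: N_def intro!: bexI[of _ 1])
    ultimately have "N = I" using max z(2) by blast
    thus ?thesis using w by (auto simp: N_def)
  qed
  have M: "is_ideal S M"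
    unfolding is_ideal_def
  proof (intro conjI ballI)
    show "M \<subseteq> S" by (auto simp: M_def)
    show "0 \<in> M" using ideal_zero[OF J(1)] subring_zero[OF S] by (simp add: M_def)
    show "u + v \<in> M" if "u \<in> M" "v \<in> M" for u v
      using that by (simp add: M_def subring_add[OF S] ideal_add[OF J(1)] distrib_right)
    show "r * u \<in> M" if "r \<in> S" "u \<in> M" for r u
      using that by (simp add: M_def subring_mult[OF S] ideal_mult[OF J(1)] mult.assoc)
  qed
  have "a \<in> M \<or> b \<in> M" if ab: "a \<in> S" "b \<in> S" "a * b \<in> M" for a b
  proof (rule ccontr)
    assume "\<not> ?thesis"
    hence "a * y \<notin> J" "b * y \<notin> J" using ab by (auto simp: M_def)
    \<comment> \<open>As \<open>a * y\<close> generates \<open>I\<close> modulo \<open>J\<close>,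
      \<open>y\<close> is a multiple \<open>r * (a * y)\<close> modulo \<open>J\<close>; multiplying
      by \<open>b\<close> and using \<open>a * b \<in> M\<close> puts \<open>b * y\<close> into
      \<open>J\<close>.\<close>
    then obtain r where r: "r \<in> S" "y - r * (a * y) \<in> J"
      using gen[of "a * y" y] ideal_mult[OF I ab(1) y(1)] y(1) by blast
    have "b * (y - r * (a * y)) + r * (a * b * y) \<in> J"
      using ab(3) by (intro ideal_add[OF J(1)] ideal_mult[OF J(1) ab(2) r(2)]
        ideal_mult[OF J(1) r(1)]) (simp add: M_def)
    hence "b * y \<in> J" by (simp add: algebra_simps)
    with \<open>b * y \<notin> J\<close> show False by blast
  qed
  moreover have "1 \<notin> M" using y by (simp add: M_def)
  ultimately show "is_prime_ideal S M" using M by (simp add: is_prime_ideal_def)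
  \<comment> \<open>The map \<open>d \<mapsto> d * y\<close> carries a transversal of
    \<open>S / M\<close> to one of \<open>I / J\<close>.\<close>
  show "has_index I J n" if idx: "has_index S M n"
  proof -
    obtain D where D: "D \<subseteq> S" "finite D" "card D = n" "\<And>x. x \<in> S \<Longrightarrow> \<exists>d\<in>D. x - d \<in> M"
      "\<And>x c d. x \<in> S \<Longrightarrow> c \<in> D \<Longrightarrow> d \<in> D \<Longrightarrow> x - c \<in> M \<Longrightarrow> x - d \<in> M \<Longrightarrow> c = d"
      using has_indexE[OF idx] by metis
    have uniq: "d = d'" if "d \<in> D" "d' \<in> D" "w - d * y \<in> J" "w - d' * y \<in> J" for d d' w
    proof -
      have "d' - d \<in> M"
        using ideal_diff[OF S J(1) that(3,4)] that D(1)
        by (auto simp: M_def algebra_simps intro: subring_diff[OF S])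
      moreover have "d' - d' \<in> M" using ideal_zero[OF M] by simp
      ultimately show ?thesis using D(5)[of d' d d'] D(1) that by blast
    qed
    have "inj_on (\<lambda>d. d * y) D"
      using uniq ideal_zero[OF J(1)] by (intro inj_onI) (metis diff_self)
    hence "card ((\<lambda>d. d * y) ` D) = n" by (simp add: card_image D(3))
    moreover have "(\<lambda>d. d * y) ` D \<subseteq> I" using ideal_mult[OF I _ y(1)] D(1) by auto
    moreover have "\<exists>e\<in>(\<lambda>d. d * y) ` D. w - e \<in> J" if w: "w \<in> I" for w
    proof -
      obtain r where r: "r \<in> S" "w - r * y \<in> J" using gen[OF y w] by blast
      then obtain d where d: "d \<in> D" "r - d \<in> M" using D(4) by blast
      have "w - d * y \<in> J"
        using ideal_add[OF J(1) r(2), of "(r - d) * y"] d(2) by (simp add: M_def algebra_simps)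
      with d(1) show ?thesis by blast
    qed
    moreover have "e = e'"
      if "e \<in> (\<lambda>d. d * y) ` D" "e' \<in> (\<lambda>d. d * y) ` D" "w - e \<in> J" "w - e' \<in> J" for e e' w
      using that uniq by blast
    ultimately show ?thesis using D(2) by (intro has_indexI[of "(\<lambda>d. d * y) ` D"]) auto
  qed
qed

text \<open>Finiteness of \<open>S / t S\<close>, expressed by a finite set that meets every class;
  distinct elements may share a class, which lets such sets be combined freely.\<close>

definition finite_mod :: "'a::comm_ring_1 set \<Rightarrow> nat \<Rightarrow> bool"
  where "finite_mod S t \<longleftrightarrow> (\<exists>D\<subseteq>S. finite D \<and> (\<forall>x\<in>S. \<exists>d\<in>D. \<exists>s\<in>S. x = d + of_nat t * s))"

text \<open>Expansion in base \<open>p\<close> with digits in a finite set, one digit per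
  step.\<close>

lemma finite_mod_power:
  assumes S: "is_subring S" and p: "finite_mod S p"
  shows "finite_mod S (p ^ k)"
proof (induction k)
  case 0
  show ?case unfolding finite_mod_def
    by (rule exI[of _ "{0}"]) (auto intro: subring_zero[OF S])
next
  case (Suc k)
  obtain D where D: "D \<subseteq> S" "finite D" "\<And>x. x \<in> S \<Longrightarrow> \<exists>d\<in>D. \<exists>s\<in>S. x = d + of_nat p * s"
    using p unfolding finite_mod_def by blast
  obtain C where C: "C \<subseteq> S" "finite C" "\<And>x. x \<in> S \<Longrightarrow> \<exists>d\<in>C. \<exists>s\<in>S. x = d + of_nat (p ^ k) * s"
    using Suc unfolding finite_mod_def by blast
  define E where "E = (\<lambda>(c, d). c + of_nat (p ^ k) * d) ` (C \<times> D)"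
  have "E \<subseteq> S"
    using C(1) D(1) subring_of_nat[OF S, of "p ^ k"]
    by (auto simp: E_def simp del: of_nat_power intro!: subring_add[OF S] subring_mult[OF S])
  moreover have "finite E" unfolding E_def using C(2) D(2) by simp
  moreover have "\<exists>e\<in>E. \<exists>s\<in>S. x = e + of_nat (p ^ Suc k) * s" if x: "x \<in> S" for x
  proof -
    obtain c s where cs: "c \<in> C" "s \<in> S" "x = c + of_nat (p ^ k) * s" using C(3)[OF x] by blast
    obtain d t where dt: "d \<in> D" "t \<in> S" "s = d + of_nat p * t" using D(3)[OF cs(2)] by blast
    have "x = (c + of_nat (p ^ k) * d) + of_nat (p ^ Suc k) * t"
      by (simp add: cs(3) dt(3) algebra_simps)
    moreover have "c + of_nat (p ^ k) * d \<in> E" using cs dt by (auto simp: E_def)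
    ultimately show ?thesis using dt(2) by blast
  qed
  ultimately show ?case unfolding finite_mod_def by blast
qed

text \<open>An ideal containing \<open>t\<close> is a union of classes modulo \<open>t S\<close>, so
  it is determined by the representatives in \<open>D\<close> that belong to it.\<close>

lemma finite_ideals_containing:
  assumes S: "is_subring S" and t: "finite_mod S t"
  shows "finite {I. is_ideal S I \<and> of_nat t \<in> I}"
proof -
  obtain D where D: "D \<subseteq> S" "finite D" "\<And>x. x \<in> S \<Longrightarrow> \<exists>d\<in>D. \<exists>s\<in>S. x = d + of_nat t * s"
    using t unfolding finite_mod_def by blast
  have "inj_on (\<lambda>I. I \<inter> D) {I. is_ideal S I \<and> of_nat t \<in> I}"
  proof (rule inj_onI)
    fix I J
    have *: "I \<subseteq> J" if "is_ideal S I \<and> of_nat t \<in> I" "is_ideal S J \<and> of_nat t \<in> J" "I \<inter> D = J \<inter> D" for I J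
    proof
      fix x assume x: "x \<in> I"
      have "x \<in> S" using x that(1) ideal_subset[of S I] by blast
      then obtain d s where ds: "d \<in> D" "s \<in> S" "x = d + of_nat t * s"
        using D(3) by blast
      have "d = x - of_nat t * s" by (simp add: ds)
      also have "\<dots> \<in> I"
        using that(1) x ds(2) by (intro ideal_diff[OF S, of I] ideal_mult_right[of S I]) auto
      finally have "d \<in> J" using that(3) ds(1) by blast
      thus "x \<in> J"
        unfolding ds(3) using that(2) ds(2) by (intro ideal_add[of S J] ideal_mult_right[of S J]) auto
    qed
    show "I = J" if "I \<in> {I. is_ideal S I \<and> of_nat t \<in> I}" "J \<in> {I. is_ideal S I \<and> of_nat t \<in> I}"
      "I \<inter> D = J \<inter> D" using *[of I J] *[of J I] that by auto
  qed
  thus ?thesis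
    by (rule inj_on_finite[where B = "Pow D"]) (use D(2) in auto)
qed

lemma finite_add_cosets:
  assumes S: "is_subring S" and I: "is_ideal S I" and t: "finite_mod S t" "of_nat t \<in> I"
  shows "finite (add_coset S I ` S)"
proof -
  obtain D where D: "D \<subseteq> S" "finite D" "\<And>x. x \<in> S \<Longrightarrow> \<exists>d\<in>D. \<exists>s\<in>S. x = d + of_nat t * s"
    using t unfolding finite_mod_def by blast
  have "add_coset S I ` S \<subseteq> add_coset S I ` D"
  proof
    fix Q assume "Q \<in> add_coset S I ` S"
    then obtain x where x: "x \<in> S" "Q = add_coset S I x" by blast
    then obtain d s where ds: "d \<in> D" "s \<in> S" "x = d + of_nat t * s" using D(3) by blast
    have "x - d \<in> I" using ds ideal_mult_right[OF I ds(2) t(2)] by simp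
    hence "Q = add_coset S I d" using add_coset_eq_iff[OF S I x(1)] ds(1) D(1) x(2) by blast
    thus "Q \<in> add_coset S I ` D" using ds(1) by blast
  qed
  thus ?thesis using D(2) finite_surj by blast
qed

lemma ideal_of_prime_power_index:
  fixes S :: "'a::field_char_0 set"
  assumes S: "is_subring S" and p: "Factorial_Ring.prime (p::nat)" "finite_mod S p"
    and nondiv: "\<And>x. x \<in> S \<Longrightarrow> of_nat p * x \<noteq> 1"
    and residue: "\<And>M. is_prime_ideal S M \<Longrightarrow> of_nat p \<in> M \<Longrightarrow> has_index S M p"
  shows "\<exists>I. is_ideal S I \<and> of_nat (p ^ k) \<in> I \<and> has_index S I (p ^ k)"
proof (induction k)
  case 0
  show ?case
    using is_ideal_self[OF S] has_index_self[OF S] subring_one[OF S] by (intro exI[of _ S]) auto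
next
  case (Suc k)
  then obtain I where I: "is_ideal S I" "of_nat (p ^ k) \<in> I" "has_index S I (p ^ k)" by blast
  have IS: "I \<subseteq> S" using I(1) by (rule ideal_subset)
  have p0: "of_nat p \<noteq> (0::'a)" using p(1) prime_gt_0_nat[of p] by simp
  have pS: "of_nat p \<in> S" by (rule subring_of_nat[OF S])
  define L where "L = (*) (of_nat p) ` I"
  have L: "is_ideal S L" unfolding L_def by (rule is_ideal_multiples[OF I(1) pS])
  have LI: "L \<subseteq> I" unfolding L_def using ideal_mult[OF I(1) pS] by auto
  have "L \<noteq> I"
  proof
    assume eq: "L = I"
    \<comment> \<open>If \<open>p I = I\<close>, then \<open>p ^ k\<close> is \<open>p ^ j\<close>
      times an element of \<open>I\<close> for every \<open>j\<close>; taking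
      \<open>j = k + 1\<close> produces an inverse of \<open>p\<close> in \<open>S\<close>.\<close>
    have div: "\<exists>x\<in>I. of_nat (p ^ k) = of_nat (p ^ j) * x" for j
    proof (induction j)
      case 0 show ?case using I(2) by auto
    next
      case (Suc j)
      then obtain x where x: "x \<in> I" "of_nat (p ^ k) = of_nat (p ^ j) * x" by blast
      then obtain z where "z \<in> I" "x = of_nat p * z" using eq by (auto simp: L_def)
      thus ?case using x(2) by (intro bexI[of _ z]) (simp_all add: algebra_simps)
    qed
    obtain x where x: "x \<in> I" "of_nat (p ^ k) = of_nat (p ^ Suc k) * x" using div by blast
    hence "of_nat p * x = 1" using p0 by simp
    thus False using nondiv x(1) IS by blast
  qed
  define Q where "Q = {J. is_ideal S J \<and> L \<subseteq> J \<and> J \<subset> I}"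
  have pk: "of_nat (p ^ Suc k) \<in> L" unfolding L_def using I(2) by (auto intro!: image_eqI)
  have "Q \<subseteq> {J. is_ideal S J \<and> of_nat (p ^ Suc k) \<in> J}" unfolding Q_def using pk by blast
  hence "finite Q"
    using finite_ideals_containing[OF S finite_mod_power[OF S p(2)]] finite_subset by blast
  moreover have "L \<in> Q" unfolding Q_def using L LI \<open>L \<noteq> I\<close> by blast
  ultimately obtain J where J: "J \<in> Q" "\<And>N. N \<in> Q \<Longrightarrow> J \<subseteq> N \<Longrightarrow> N = J"
    using finite_has_maximal[of Q] by blast
  have J': "is_ideal S J" "J \<subset> I" "L \<subseteq> J" using J(1) by (auto simp: Q_def)
  obtain y where y: "y \<in> I" "y \<notin> J" using J' by blast
  have max: "N = J \<or> N = I" if "is_ideal S N" "J \<subseteq> N" "N \<subseteq> I" for N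
    using J(2)[of N] that J'(3) by (auto simp: Q_def)
  define M where "M = {x \<in> S. x * y \<in> J}"
  have "is_prime_ideal S M"
    unfolding M_def by (rule maximal_subideal_quotient(1)[OF S I(1) J'(1,2) max y])
  \<comment> \<open>\<open>p * y\<close> lies in \<open>p I\<close>, hence in \<open>J\<close>: this
    is why the candidates were required to contain \<open>L\<close>.\<close>
  moreover have "of_nat p \<in> M" using pS y(1) J'(3) by (auto simp: M_def L_def)
  ultimately have "has_index S M p" by (rule residue)
  hence "has_index I J p"
    unfolding M_def by (intro maximal_subideal_quotient(2)[OF S I(1) J'(1,2) _ y] max)
  hence "has_index S J (p ^ k * p)"
    using has_index_tower[OF S I(1) J'(1) _ I(3)] J'(2) by blast
  thus ?case using J'(1,3) pk by (auto simp: mult.commute)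
qed

section \<open>Finiteness modulo a prime\<close>

interpretation rat_space: vector_space "\<lambda>(q::rat) (x::'a::field_char_0). of_rat q * x"
  by unfold_locales (simp_all add: algebra_simps of_rat_add of_rat_mult)

text \<open>Each line extension contributes one spanning vector. The resulting finite
  \<open>B\<close> bounds the size of rationally independent subsets of \<open>K\<close>.\<close>

lemma finite_dimension_imp_finite_span:
  fixes K :: "'a::field_char_0 set"
  assumes "ring.finite_dimension ring_of_type_algebra \<rat> K"
  shows "\<exists>B. finite B \<and> K \<subseteq> rat_space.span B"
proof -
  interpret R: ring "ring_of_type_algebra :: 'a ring" by (rule ring_from_type_algebra)
  have "\<exists>B. finite B \<and> E \<subseteq> rat_space.span B" if "R.dimension n \<rat> E" for n E
    using that
  proof (induction n "\<rat> :: 'a set" E rule: R.dimension.induct)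
    case zero_dim
    show ?case by (rule exI[of _ "{}"]) (simp add: ring_of_type_algebra_def)
  next
    case (Suc_dim v E n)
    then obtain B where B: "finite B" "E \<subseteq> rat_space.span B" by blast
    have "R.line_extension \<rat> v E \<subseteq> rat_space.span (insert v B)"
    proof
      fix x assume "x \<in> R.line_extension \<rat> v E"
      then obtain q e where x: "q \<in> \<rat>" "e \<in> E" "x = q * v + e"
        unfolding R.line_extension_def
        by (auto simp: set_add_def set_mult_def r_coset_def
            ring_of_type_algebra_def)
      then obtain r where r: "q = of_rat r" by (auto elim: Rats_cases)
      have e: "e \<in> rat_space.span (insert v B)"
        using B(2) x(2) rat_space.span_mono[of B "insert v B"] by blast
      thus "x \<in> rat_space.span (insert v B)"
        unfolding x(3) r
        by (intro rat_space.span_add rat_space.span_scale rat_space.span_base[OF insertI1] e)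
    qed
    thus ?case using B(1) by (intro exI[of _ "insert v B"]) simp
  qed
  thus ?thesis using assms by (auto simp: R.finite_dimension_def)
qed

text \<open>A rational dependency, cleared of denominators, would be infinitely divisible by \<open>p\<close>.\<close>

lemma independent_if_independent_mod:
  fixes T S :: "'a::field_char_0 set"
  assumes S: "is_subring S" and p: "p > (1::nat)" and T: "finite T"
    and mod: "\<And>c :: 'a \<Rightarrow> int. (\<Sum>t\<in>T. of_int (c t) * t) \<in> (*) (of_nat p) ` S \<Longrightarrow> \<forall>t\<in>T. int p dvd c t"
  shows "\<not> rat_space.dependent T"
proof
  assume "rat_space.dependent T"
  then obtain u where u: "\<exists>t\<in>T. u t \<noteq> 0" "(\<Sum>t\<in>T. of_rat (u t) * t) = 0"
    using rat_space.dependent_finite[OF T] by blast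
  \<comment> \<open>A common denominator of the coefficients.\<close>
  define N where "N = (\<Prod>t\<in>T. snd (quotient_of (u t)))"
  have N: "N > 0" unfolding N_def by (intro prod_pos) (simp add: quotient_of_denom_pos')
  have "\<exists>k::int. of_int N * u t = of_int k" if t: "t \<in> T" for t
  proof -
    obtain a b where ab: "quotient_of (u t) = (a, b)" by (cases "quotient_of (u t)")
    have "b dvd N" unfolding N_def using t T ab by (metis dvd_prodI snd_conv)
    then obtain e where "N = b * e" by blast
    moreover have "u t = of_int a / of_int b" using ab by (rule quotient_of_div)
    moreover have "b > 0" using ab by (rule quotient_of_denom_pos)
    ultimately have "of_int N * u t = of_int (e * a)" by simp
    thus ?thesis by blast
  qed
  then obtain c :: "'a \<Rightarrow> int" where c: "\<And>t. t \<in> T \<Longrightarrow> of_int N * u t = of_int (c t)" by metis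
  have c': "of_int (c t) = (of_int N * of_rat (u t) :: 'a)" if "t \<in> T" for t
    using arg_cong[OF c[OF that], of "of_rat :: rat \<Rightarrow> 'a"] by (simp add: of_rat_mult)
  have "(\<Sum>t\<in>T. of_int (c t) * t) = of_int N * (\<Sum>t\<in>T. of_rat (u t) * t)"
    unfolding sum_distrib_left by (intro sum.cong refl) (simp add: c' mult.assoc)
  hence c0: "(\<Sum>t\<in>T. of_int (c t) * t) = 0" using u(2) by simp
  \<comment> \<open>Divisibility of all coefficients by \<open>p\<close> lets the relation be
    divided by \<open>p\<close>, and the quotient is a relation of the same kind.\<close>
  have pow: "\<forall>t\<in>T. int p ^ m dvd d t" if "(\<Sum>t\<in>T. of_int (d t) * t) = 0" for m d
    using that
  proof (induction m arbitrary: d)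
    case (Suc m)
    have dvd: "\<forall>t\<in>T. int p dvd d t"
      using Suc.prems subring_zero[OF S] by (intro mod) (auto intro!: image_eqI[of _ _ 0])
    have eq: "d t = int p * (d t div int p)" if "t \<in> T" for t
      using dvd that by simp
    have "of_nat p * (\<Sum>t\<in>T. of_int (d t div int p) * t) = (\<Sum>t\<in>T. of_int (int p * (d t div int p)) * t)"
      by (simp add: sum_distrib_left mult.assoc)
    also have "\<dots> = 0" using Suc.prems eq by (metis (no_types, lifting) sum.cong)
    finally have "(\<Sum>t\<in>T. of_int (d t div int p) * t) = 0" using p by simp
    hence "\<forall>t\<in>T. int p ^ m dvd d t div int p" by (rule Suc.IH)
    thus ?case using eq by (metis mult_dvd_mono dvd_refl power_Suc)
  qed simp
  obtain t where t: "t \<in> T" "u t \<noteq> 0" using u(1) by blast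
  have "c t \<noteq> 0" using c[OF t(1)] t(2) N by auto
  \<comment> \<open>The exponent is chosen as the absolute value of the coefficient because
    \<open>p ^ n > n\<close>.\<close>
  moreover have "int p ^ nat \<bar>c t\<bar> dvd c t" using pow[OF c0] t(1) by blast
  ultimately have "\<bar>int p ^ nat \<bar>c t\<bar>\<bar> \<le> \<bar>c t\<bar>" by (rule dvd_imp_le_int)
  moreover have "nat \<bar>c t\<bar> < p ^ nat \<bar>c t\<bar>" using p by (simp add: power_gt_expt)
  hence "int (nat \<bar>c t\<bar>) < int (p ^ nat \<bar>c t\<bar>)" by (simp only: of_nat_less_iff)
  ultimately show False by simp
qed

text \<open>Sets independent modulo \<open>p\<close> have at most \<open>card B\<close> elements, so
  a largest one exists; by maximality it spans \<open>S / p S\<close> over the prime field, and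
  coefficients in \<open>{0..<p}\<close> then reach every class.\<close>

lemma finite_mod_prime:
  fixes S :: "'a::field_char_0 set"
  assumes S: "is_subring S" and B: "finite B" "S \<subseteq> rat_space.span B"
    and p: "Factorial_Ring.prime (p::nat)"
  shows "finite_mod S p"
proof -
  define L where "L = (*) (of_nat p) ` S"
  have p1: "p > 1" using p by (rule prime_gt_1_nat)
  have L: "is_ideal S L"
    unfolding L_def by (rule is_ideal_multiples[OF is_ideal_self[OF S] subring_of_nat[OF S]])
  have pL: "of_nat p * x \<in> L" if "x \<in> S" for x using that unfolding L_def by (rule imageI)
  \<comment> \<open>\<open>P T\<close> is linear independence over the field with \<open>p\<close>
    elements of the images of \<open>T\<close> in \<open>S / p S\<close>, with integers as
    coefficients.\<close>
  define P where "P T \<longleftrightarrow> T \<subseteq> S \<and> finite T \<and>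
    (\<forall>c :: 'a \<Rightarrow> int. (\<Sum>t\<in>T. of_int (c t) * t) \<in> L \<longrightarrow> (\<forall>t\<in>T. int p dvd c t))" for T
  have bound: "card T \<le> card B" if "P T" for T
  proof -
    have "\<not> rat_space.dependent T"
      using that by (intro independent_if_independent_mod[OF S p1]) (auto simp: P_def L_def)
    thus ?thesis using rat_space.independent_span_bound[OF B(1)] that B(2) by (auto simp: P_def)
  qed
  have "P {}" by (simp add: P_def)
  moreover have "\<forall>T. P T \<longrightarrow> card T < Suc (card B)"
    using bound by (simp add: less_Suc_eq_le)
  ultimately have "\<exists>T. P T \<and> (\<forall>T'. P T' \<longrightarrow> card T' \<le> card T)"
    by (rule ex_has_greatest_nat)
  then obtain T where T: "P T" "\<And>T'. P T' \<Longrightarrow> card T' \<le> card T" by blast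
  have TS: "T \<subseteq> S" and fT: "finite T" using T(1) by (auto simp: P_def)
  define f where "f c = (\<Sum>t\<in>T. of_int (c t) * t)" for c :: "'a \<Rightarrow> int"
  have fS: "f c \<in> S" for c
    unfolding f_def using TS by (intro subring_sum[OF S] subring_mult[OF S] subring_of_int[OF S]) auto
  have rep: "\<exists>c. x - f c \<in> L" if x: "x \<in> S" for x
  proof (cases "x \<in> T")
    case True
    have "f (\<lambda>t. if t = x then 1 else 0) = (\<Sum>t\<in>T. if t = x then t else 0)"
      unfolding f_def by (intro sum.cong) auto
    also have "\<dots> = x" using True fT by simp
    finally show ?thesis using ideal_zero[OF L]
      by (intro exI[of _ "\<lambda>t. if t = x then 1 else 0"]) simp
  next
    case False
    have "\<not> P (insert x T)" using T(2)[of "insert x T"] False fT by auto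
    then obtain c t where c: "(\<Sum>t\<in>insert x T. of_int (c t) * t) \<in> L" "t \<in> insert x T" "\<not> int p dvd c t"
      using TS fT x by (auto simp: P_def)
    have c': "of_int (c x) * x + f c \<in> L" using c(1) False fT by (simp add: f_def)
    have "\<not> int p dvd c x"
    proof
      assume dvd: "int p dvd c x"
      then obtain k where "c x = int p * k" by blast
      hence "of_int (c x) * x = of_nat p * (of_int k * x)" by (simp add: mult.assoc)
      also have "\<dots> \<in> L" by (intro pL subring_mult[OF S] subring_of_int[OF S] x)
      finally have "f c \<in> L" using ideal_diff[OF S L c'] by fastforce
      hence "\<forall>t\<in>T. int p dvd c t" using T(1) by (auto simp: P_def f_def)
      with c(2,3) dvd show False by auto
    qed
    hence "coprime (c x) (int p)"
      using p by (metis coprime_commute prime_imp_coprime prime_int_nat_transfer prime_nat_int_transfer)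
    then obtain a b where ab: "a * c x + b * int p = 1"
      using bezout_int[of "c x" "int p"] by (auto simp: coprime_iff_gcd_eq_1)
    \<comment> \<open>\<open>a\<close> is an inverse of \<open>c x\<close> modulo \<open>p\<close>;
      multiplying the dependency by \<open>a\<close> solves it for \<open>x\<close>.\<close>
    have "x - f (\<lambda>t. - a * c t) = of_int (a * c x + b * int p) * x + of_int a * f c"
      unfolding ab by (simp add: f_def sum_distrib_left sum_negf mult.assoc)
    also have "\<dots> = of_int a * (of_int (c x) * x + f c) + of_nat p * (of_int b * x)"
      by (simp add: algebra_simps)
    also have "\<dots> \<in> L"
      by (intro ideal_add[OF L] ideal_mult[OF L _ c'] pL subring_mult[OF S] subring_of_int[OF S] x)
    finally show ?thesis by blast
  qed
  define D where "D = f ` (T \<rightarrow>\<^sub>E {0..<int p})"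
  have "finite D" unfolding D_def using fT by (intro finite_imageI finite_PiE) auto
  moreover have "D \<subseteq> S" unfolding D_def using fS by auto
  moreover have "\<exists>d\<in>D. \<exists>s\<in>S. x = d + of_nat p * s" if x: "x \<in> S" for x
  proof -
    obtain c where c: "x - f c \<in> L" using rep[OF x] by blast
    define d where "d = (\<lambda>t\<in>T. c t mod int p)"
    have "f c = (\<Sum>t\<in>T. of_int (int p * (c t div int p) + c t mod int p) * t)"
      by (simp add: f_def)
    also have "\<dots> = of_nat p * f (\<lambda>t. c t div int p) + f d"
      unfolding f_def d_def of_int_add
      by (simp add: sum_distrib_left sum.distrib algebra_simps)
    finally have "x - f d = (x - f c) + of_nat p * f (\<lambda>t. c t div int p)" by simp
    also have "\<dots> \<in> L" by (intro ideal_add[OF L] c pL fS)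
    finally obtain s where "s \<in> S" "x - f d = of_nat p * s" by (auto simp: L_def)
    moreover have "f d \<in> D" unfolding D_def d_def using p1 by (intro imageI) auto
    ultimately show ?thesis by (intro bexI[of _ "f d"] bexI[of _ s]) (auto simp: algebra_simps)
  qed
  ultimately show ?thesis unfolding finite_mod_def by blast
qed

section \<open>Residue fields\<close>

text \<open>Another prime divisor \<open>r\<close> of the order would give, by Sylow, a subgroup of
  order \<open>r\<close>; the order of an element in it divides both \<open>r\<close> and
  \<open>p\<close>, so the subgroup would be trivial.\<close>

lemma (in group) order_prime_power:
  assumes fin: "finite (carrier G)" and p: "Factorial_Ring.prime (p::nat)"
    and exp: "\<And>x. x \<in> carrier G \<Longrightarrow> x [^] p = \<one>"
  shows "\<exists>f. Coset.order G = p ^ f"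
proof -
  have eq: "r = p" if r: "Factorial_Ring.prime r" "r dvd Coset.order G" for r
  proof (rule ccontr)
    assume ne: "r \<noteq> p"
    obtain m where "Coset.order G = r ^ 1 * m" using r(2) by auto
    then obtain H where H: "subgroup H G" "card H = r ^ 1"
      using sylow_thm[OF r(1) is_group _ fin, of 1 m] by blast
    have r1: "r > 1" using r(1) by (rule prime_gt_1_nat)
    have "H \<noteq> {\<one>}" using H(2) r1 by auto
    moreover have "\<one> \<in> H" by (rule subgroup.one_closed[OF H(1)])
    ultimately obtain h where h: "h \<in> H" "h \<noteq> \<one>" by blast
    have hG: "h \<in> carrier G" by (rule subgroup.mem_carrier[OF H(1) h(1)])
    interpret H: group "G\<lparr>carrier := H\<rparr>" by (rule subgroup.subgroup_is_group[OF H(1) is_group])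
    have "h [^]\<^bsub>G\<lparr>carrier := H\<rparr>\<^esub> Coset.order (G\<lparr>carrier := H\<rparr>) = \<one>\<^bsub>G\<lparr>carrier := H\<rparr>\<^esub>"
      using h(1) by (intro H.pow_order_eq_1) simp
    hence "h [^] r = \<one>" using H(2) nat_pow_consistent[of h r H] by (simp add: Coset.order_def)
    hence "ord h dvd r" "ord h dvd p" using pow_eq_id[OF hG] exp[OF hG] by auto
    moreover have "coprime r p" using ne r(1) p by (simp add: primes_coprime)
    ultimately have "ord h = 1" by (metis coprime_common_divisor_nat)
    thus False using ord_eq_1[OF hG] h(2) by simp
  qed
  have pos: "Coset.order G > 0" using fin order_gt_0_iff_finite by simp
  obtain m where m: "Coset.order G = p ^ multiplicity p (Coset.order G) * m" "\<not> p dvd m"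
    using multiplicity_decompose'[of "Coset.order G" p] pos p by (metis not_prime_unit gr_implies_not0)
  have "m = 1"
  proof (rule ccontr)
    assume "m \<noteq> 1"
    then obtain r where "Factorial_Ring.prime r" "r dvd m" using prime_factor_nat by blast
    with eq[of r] m show False by (metis dvd_mult)
  qed
  thus ?thesis using m(1) by auto
qed

text \<open>Modulo \<open>p ^ f - 1\<close> the power \<open>p ^ l\<close> reduces to
  \<open>p ^ (l mod f)\<close>. So \<open>p ^ (l mod f) - 1\<close> is divisible by a number larger
  than itself and vanishes.\<close>

lemma exponent_dvd_if_power_diff_dvd:
  fixes p f l :: nat
  assumes p: "p > 1" and f: "f > 0" and dvd: "p ^ f - 1 dvd p ^ l - 1"
  shows "f dvd l"
proof -
  have cong: "[p ^ l = p ^ (l mod f)] (mod (p ^ f - 1))"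
  proof -
    have "[p ^ f = 1] (mod (p ^ f - 1))" using p by (simp add: cong_diff_iff_cong_0_nat cong_sym cong_altdef_nat)
    hence "[(p ^ f) ^ (l div f) * p ^ (l mod f) = 1 ^ (l div f) * p ^ (l mod f)] (mod (p ^ f - 1))"
      by (intro cong_mult cong_pow) auto
    moreover have "(p ^ f) ^ (l div f) * p ^ (l mod f) = p ^ l"
      by (simp flip: power_mult power_add)
    ultimately show ?thesis by simp
  qed
  have "[p ^ l = 1] (mod (p ^ f - 1))" using dvd p by (simp add: cong_altdef_nat)
  hence "[p ^ (l mod f) = 1] (mod (p ^ f - 1))" using cong cong_sym cong_trans by blast
  hence "p ^ f - 1 dvd p ^ (l mod f) - 1" using p by (simp add: cong_altdef_nat)
  moreover have "p ^ (l mod f) < p ^ f" using p f by (simp add: power_strict_increasing)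
  moreover have "p ^ (l mod f) \<ge> 1" using p by simp
  ultimately have "p ^ (l mod f) - 1 = 0"
    by (metis diff_less_mono dvd_imp_le gr0I leD)
  hence "l mod f = 0" using p by (metis One_nat_def Suc_leI diff_is_0_eq gr0I leD one_less_power)
  thus ?thesis by (simp add: dvd_eq_mod_eq_0)
qed

text \<open>The additive group has exponent \<open>p\<close>, hence order \<open>p ^ f\<close>. The
  power identity makes nonzero elements invertible of order dividing \<open>p ^ l - 1\<close>, and a
  generator of the cyclic unit group has order \<open>p ^ f - 1\<close>; thus \<open>f\<close>
  divides the prime \<open>l\<close>.\<close>

lemma (in domain) card_domain_power_eq_self:
  assumes fin: "finite (carrier R)" and p: "Factorial_Ring.prime (p::nat)" and l: "Factorial_Ring.prime (l::nat)"
    and char: "\<And>x. x \<in> carrier R \<Longrightarrow> add_pow R p x = \<zero>"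
    and frob: "\<And>x. x \<in> carrier R \<Longrightarrow> x [^] (p ^ l) = x"
  shows "card (carrier R) \<in> {p, p ^ l}"
proof -
  have p1: "p > 1" using p by (rule prime_gt_1_nat)
  obtain f where "Coset.order (add_monoid R) = p ^ f"
    using group.order_prime_power[OF add.is_group _ p] fin char by (auto simp: add_pow_def)
  hence f: "card (carrier R) = p ^ f" by (simp add: Coset.order_def)
  have "card {\<zero>, \<one>} \<le> card (carrier R)" by (intro card_mono fin) auto
  hence "p ^ f \<ge> 2" using f by simp
  hence f0: "f > 0" by (cases f) auto
  have pl1: "p ^ l > 1" using p1 prime_gt_0_nat[OF l] by (rule one_less_power)
  have inv: "a [^] (p ^ l - 1) = \<one>" if a: "a \<in> carrier R" "a \<noteq> \<zero>" for a
  proof -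
    have "a \<otimes> a [^] (p ^ l - 1) = a [^] Suc (p ^ l - 1)" using a nat_pow_Suc2 by simp
    also have "Suc (p ^ l - 1) = p ^ l" using p1 by simp
    finally have "a \<otimes> a [^] (p ^ l - 1) = a \<otimes> \<one>" using frob[OF a(1)] a(1) by simp
    thus ?thesis by (rule m_lcancel[OF a(2,1), THEN iffD1, rotated 2]) (use a(1) in auto)
  qed
  have "Units R = carrier R - {\<zero>}"
  proof (intro equalityI subsetI DiffI)
    fix a assume a: "a \<in> carrier R - {\<zero>}"
    obtain k where k: "p ^ l - 1 = Suc k" using pl1 by (cases "p ^ l - 1") auto
    have "a \<otimes> a [^] k = a [^] Suc k" using a by (intro nat_pow_Suc2[symmetric]) simp
    also have "\<dots> = \<one>" using inv[of a] a unfolding k by blast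
    finally have "a \<otimes> a [^] k = \<one>" .
    moreover from this have "a [^] k \<otimes> a = \<one>" using a m_comm[of "a [^] k" a] by simp
    ultimately show "a \<in> Units R" using a unfolding Units_def by blast
  qed (auto simp: Units_def)
  then interpret field R by (rule cring_fieldI)
  interpret M: group "Multiplicative_Group.mult_of R" by (rule field_mult_group)
  obtain a where a: "a \<in> carrier (Multiplicative_Group.mult_of R)" "carrier (Multiplicative_Group.mult_of R) = {a [^] i | i::nat. i \<in> UNIV}"
    using finite_field_mult_group_has_gen[OF fin] by blast
  have aR: "a \<in> carrier R" "a \<noteq> \<zero>" using a(1) by auto
  have "a [^] (p ^ l - 1) = \<one>" by (rule inv[OF aR])
  hence *: "M.ord a dvd p ^ l - 1" using M.pow_eq_id[OF a(1)] by (simp add: Multiplicative_Group.nat_pow_mult_of)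
  \<comment> \<open>The value 0 of \<open>ord\<close> encodes infinite order; it would divide only
    0.\<close>
  hence "M.ord a \<noteq> 0" using pl1 by (metis dvd_0_left_iff zero_less_diff less_irrefl)
  hence "generate (Multiplicative_Group.mult_of R) {a} = carrier (Multiplicative_Group.mult_of R)"
    using M.generate_pow_nat[OF a(1)] a(2) by (simp add: Multiplicative_Group.nat_pow_mult_of)
  hence "M.ord a = card (carrier (Multiplicative_Group.mult_of R))" using M.generate_pow_card[OF a(1)] by simp
  also have "\<dots> = p ^ f - 1" using f fin by (simp add: card_Diff_singleton)
  finally have "f dvd l" using * exponent_dvd_if_power_diff_dvd[OF p1 f0] by simp
  hence "f = 1 \<or> f = l" using l by (auto simp: prime_nat_iff)
  thus ?thesis using f by auto
qed

section \<open>Passage between subsets of a type and the rings, ideals and quotients of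
  HOL-Algebra\<close>

lemma ring_on_simps [simp]:
  "carrier (ring_on S) = S" "monoid.mult (ring_on S) = (*)" "ring.add (ring_on S) = (+)"
  "monoid.one (ring_on S) = 1" "ring.zero (ring_on S) = 0"
  by (simp_all add: ring_on_def ring_of_type_algebra_def)

lemma cring_ring_on:
  fixes S :: "'a::comm_ring_1 set"
  assumes S: "is_subring S"
  shows "cring (ring_on S)"
  by (intro cringI abelian_groupI comm_monoidI)
    (auto simp: algebra_simps intro: subring_add[OF S] subring_mult[OF S] subring_one[OF S]
      subring_zero[OF S] bexI[OF _ subring_uminus[OF S]])

lemma nat_pow_ring_on [simp]: "x [^]\<^bsub>ring_on S\<^esub> (n::nat) = x ^ n"
  by (induction n) (simp_all add: nat_pow_def power_commutes)

lemma ideal_ring_on_iff: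
  fixes S :: "'a::comm_ring_1 set"
  assumes S: "is_subring S"
  shows "ideal I (ring_on S) \<longleftrightarrow> is_ideal S I"
proof
  assume "ideal I (ring_on S)"
  then interpret ideal I "ring_on S" .
  show "is_ideal S I"
    using a_subset additive_subgroup.zero_closed[OF additive_subgroup_axioms]
      additive_subgroup.a_closed[OF additive_subgroup_axioms] I_l_closed
    by (auto simp: is_ideal_def)
next
  assume I: "is_ideal S I"
  interpret cring "ring_on S" by (rule cring_ring_on[OF S])
  have minus: "\<ominus>\<^bsub>ring_on S\<^esub> x = - x" if "x \<in> S" for x
    using that subring_uminus[OF S that] by (intro minus_equality) auto
  show "ideal I (ring_on S)"
  proof (rule idealI)
    show "ring (ring_on S)" by (rule ring_axioms)
    show "subgroup I (add_monoid (ring_on S))"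
      using ideal_subset[OF I] ideal_zero[OF I] ideal_add[OF I] minus ideal_uminus[OF S I]
      by (intro add.subgroupI) (auto simp flip: a_inv_def)
  qed (use I in \<open>auto intro: ideal_mult ideal_mult_right\<close>)
qed

lemma a_r_coset_ring_on:
  fixes S :: "'a::comm_ring_1 set"
  assumes S: "is_subring S" and I: "is_ideal S I" and x: "x \<in> S"
  shows "I +>\<^bsub>ring_on S\<^esub> x = add_coset S I x"
proof (intro equalityI subsetI)
  fix y assume "y \<in> add_coset S I x"
  hence "y - x \<in> I" "y = (y - x) + x" by (auto simp: add_coset_def)
  thus "y \<in> I +>\<^bsub>ring_on S\<^esub> x"
    by (simp add: a_r_coset_def r_coset_def) (metis diff_add_cancel)
qed (use x ideal_subset[OF I] in
    \<open>auto simp: a_r_coset_def r_coset_def add_coset_def intro: subring_add[OF S]\<close>)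

lemma a_rcosets_ring_on:
  fixes S :: "'a::comm_ring_1 set"
  assumes S: "is_subring S" and I: "is_ideal S I"
  shows "a_rcosets\<^bsub>ring_on S\<^esub> I = add_coset S I ` S"
proof -
  have "a_rcosets\<^bsub>ring_on S\<^esub> I = (\<Union>x\<in>S. {I +>\<^bsub>ring_on S\<^esub> x})"
    by (simp add: A_RCOSETS_def RCOSETS_def a_r_coset_def)
  thus ?thesis using a_r_coset_ring_on[OF S I] by auto
qed

lemma carrier_ring_on_Quot:
  fixes S :: "'a::comm_ring_1 set"
  assumes "is_subring S" "is_ideal S I"
  shows "carrier (ring_on S Quot I) = add_coset S I ` S"
  using a_rcosets_ring_on[OF assms] by (simp add: FactRing_def)

text \<open>Serves both the characteristic of the residue ring and the use of Lagrange's theorem in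
  the additive quotient.\<close>

lemma add_pow_ring_on_Quot:
  fixes S :: "'a::comm_ring_1 set"
  assumes S: "is_subring S" and I: "is_ideal S I" and x: "x \<in> S"
  shows "add_pow (ring_on S Quot I) (n::nat) (add_coset S I x) = add_coset S I (of_nat n * x)"
proof -
  define R where "R = ring_on S"
  interpret R: cring R unfolding R_def by (rule cring_ring_on[OF S])
  interpret I: ideal I R unfolding R_def using I ideal_ring_on_iff[OF S] by simp
  interpret Q: cring "R Quot I" by (rule I.quotient_is_cring[OF R.is_cring])
  interpret h: ring_hom_ring R "R Quot I" "(+>\<^bsub>R\<^esub>) I" by (rule I.rcos_ring_hom_ring)
  have nx: "of_nat k * x \<in> S" for k by (intro subring_mult[OF S] subring_of_nat[OF S] x)
  have coset: "add_coset S I y = I +>\<^bsub>R\<^esub> y" if "y \<in> S" for y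
    unfolding R_def by (rule a_r_coset_ring_on[OF S I that, symmetric])
  have "add_pow (R Quot I) n (I +>\<^bsub>R\<^esub> x) = I +>\<^bsub>R\<^esub> (of_nat n * x)"
  proof (induction n)
    case 0
    have "I +>\<^bsub>R\<^esub> (of_nat 0 * x) = \<zero>\<^bsub>R Quot I\<^esub>" using h.hom_zero by (simp add: R_def)
    thus ?case using Q.add.nat_pow_0 by simp
  next
    case (Suc n)
    have "add_pow (R Quot I) (Suc n) (I +>\<^bsub>R\<^esub> x) =
        add_pow (R Quot I) n (I +>\<^bsub>R\<^esub> x) \<oplus>\<^bsub>R Quot I\<^esub> (I +>\<^bsub>R\<^esub> x)"
      by (rule Q.add.nat_pow_Suc)
    also have "\<dots> = I +>\<^bsub>R\<^esub> (of_nat n * x + x)"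
      unfolding Suc using h.hom_add[of "of_nat n * x" x] x nx by (simp add: R_def)
    finally show ?case by (simp add: algebra_simps)
  qed
  thus ?thesis unfolding coset[OF x] coset[OF nx] by (simp only: R_def)
qed

text \<open>Lagrange's theorem for the class of 1 in the additive quotient group. It places every
  ideal of a given finite index in the finite family of ideals containing that number.\<close>

lemma of_nat_index_in_ideal:
  fixes S :: "'a::comm_ring_1 set"
  assumes S: "is_subring S" and I: "is_ideal S I" and fin: "finite (add_coset S I ` S)"
  shows "of_nat (card (add_coset S I ` S)) \<in> I"
proof -
  let ?Q = "ring_on S Quot I"
  interpret R: cring "ring_on S" by (rule cring_ring_on[OF S])
  interpret I: ideal I "ring_on S" using I ideal_ring_on_iff[OF S] by simp
  interpret Q: cring ?Q by (rule I.quotient_is_cring[OF R.is_cring])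
  have one: "1 \<in> S" and zero: "0 \<in> S" using subring_one[OF S] subring_zero[OF S] by auto
  let ?n = "card (add_coset S I ` S)"
  have "add_pow ?Q ?n (add_coset S I 1) = \<zero>\<^bsub>?Q\<^esub>"
    using Q.add.pow_order_eq_1[of "add_coset S I 1"] carrier_ring_on_Quot[OF S I] one
    by (simp add: Coset.order_def add_pow_def)
  also have "\<dots> = add_coset S I 0"
    using add_pow_ring_on_Quot[OF S I zero, of 0] Q.add.nat_pow_0 by simp
  finally have "add_coset S I (of_nat ?n) = add_coset S I 0"
    using add_pow_ring_on_Quot[OF S I one, of ?n] by simp
  thus ?thesis using add_coset_eq_iff[OF S I subring_of_nat[OF S] zero] by simp
qed

lemma card_residue_field:
  fixes S :: "'a::comm_ring_1 set"
  assumes S: "is_subring S" and M: "is_prime_ideal S M"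
    and p: "Factorial_Ring.prime (p::nat)" "of_nat p \<in> M" and l: "Factorial_Ring.prime (l::nat)"
    and fin: "finite (add_coset S M ` S)"
    and frob: "\<And>x. x \<in> S \<Longrightarrow> x ^ (p ^ l) - x \<in> M"
  shows "card (add_coset S M ` S) \<in> {p, p ^ l}"
proof -
  have I: "is_ideal S M" using M by (simp add: is_prime_ideal_def)
  define R where "R = ring_on S"
  interpret R: cring R unfolding R_def by (rule cring_ring_on[OF S])
  interpret M: ideal M R unfolding R_def using I ideal_ring_on_iff[OF S] by simp
  have "primeideal M R"
    using M subring_one[OF S] by (intro primeidealI M.ideal_axioms R.is_cring)
      (auto simp: R_def is_prime_ideal_def)
  then interpret domain "R Quot M" by (rule primeideal.quotient_is_domain)
  have carr: "carrier (R Quot M) = add_coset S M ` S"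
    unfolding R_def by (rule carrier_ring_on_Quot[OF S I])
  interpret h: ring_hom_ring R "R Quot M" "(+>\<^bsub>R\<^esub>) M" by (rule M.rcos_ring_hom_ring)
  have coset: "M +>\<^bsub>R\<^esub> x = add_coset S M x" if "x \<in> S" for x
    unfolding R_def by (rule a_r_coset_ring_on[OF S I that])
  have surj: "\<exists>x\<in>S. X' = M +>\<^bsub>R\<^esub> x" if "X' \<in> carrier (R Quot M)" for X'
    using that coset by (auto simp: carr)
  have coset_eq: "M +>\<^bsub>R\<^esub> x = M +>\<^bsub>R\<^esub> y" if "x \<in> S" "y \<in> S" "x - y \<in> M" for x y
    using that add_coset_eq_iff[OF S I] coset by simp
  have "card (carrier (R Quot M)) \<in> {p, p ^ l}"
  proof (rule card_domain_power_eq_self[OF _ p(1) l])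
    show "finite (carrier (R Quot M))" using fin carr by simp
  next
    fix X' assume "X' \<in> carrier (R Quot M)"
    then obtain x where x: "x \<in> S" "X' = M +>\<^bsub>R\<^esub> x" using surj by blast
    have "of_nat p * x - 0 \<in> M" using ideal_mult_right[OF I x(1) p(2)] by simp
    hence "M +>\<^bsub>R\<^esub> (of_nat p * x) = M +>\<^bsub>R\<^esub> 0"
      using x(1) subring_of_nat[OF S] subring_mult[OF S] subring_zero[OF S] by (intro coset_eq) auto
    thus "add_pow (R Quot M) p X' = \<zero>\<^bsub>R Quot M\<^esub>"
      unfolding x(2) using add_pow_ring_on_Quot[OF S I x(1), of p] h.hom_zero
        coset[OF x(1)] coset[OF subring_mult[OF S subring_of_nat[OF S] x(1)]] by (simp add: R_def)
    have "X' [^]\<^bsub>R Quot M\<^esub> (p ^ l) = M +>\<^bsub>R\<^esub> (x ^ (p ^ l))"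
      unfolding x(2) using h.hom_nat_pow[of x "p ^ l"] x(1) by (simp add: R_def)
    also have "\<dots> = X'"
      unfolding x(2) using x(1) frob by (intro coset_eq subring_power[OF S])
    finally show "X' [^]\<^bsub>R Quot M\<^esub> (p ^ l) = X'" .
  qed
  thus ?thesis by (simp add: carr)
qed

section \<open>The Galois action on the ring of integers\<close>

lemma is_subring_subfield:
  fixes K :: "'a::field set"
  assumes "subfield K ring_of_type_algebra"
  shows "is_subring K"
proof -
  interpret R: field "ring_of_type_algebra :: 'a ring" by (rule field_from_type_algebra)
  have "subring K ring_of_type_algebra" using assms by (rule subfieldE(1))
  note K = subringE[OF this]
  have minus: "\<ominus>\<^bsub>ring_of_type_algebra\<^esub> x = - x" for x :: 'a
    by (intro R.minus_equality) (auto simp: ring_of_type_algebra_def)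
  have "1 \<in> K" "\<And>x y. x \<in> K \<Longrightarrow> y \<in> K \<Longrightarrow> x + y \<in> K" "\<And>x y. x \<in> K \<Longrightarrow> y \<in> K \<Longrightarrow> x * y \<in> K"
    "\<And>x. x \<in> K \<Longrightarrow> - x \<in> K"
    using K minus by (auto simp: ring_of_type_algebra_def)
  thus ?thesis unfolding is_subring_def by (metis diff_conv_add_uminus)
qed

lemma is_subring_algebraic_ints:
  fixes K :: "'a::field_char_0 set"
  assumes K: "is_subring K"
  shows "is_subring {x \<in> K. algebraic_int x}"
  using algebraic_int_plus_times subring_one[OF K] subring_diff[OF K] subring_mult[OF K]
  unfolding is_subring_def by (auto simp: diff_conv_add_uminus simp del: add_uminus_conv_diff)

lemma algebraic_int_hom_on:
  fixes K :: "'a::field_char_0 set" and h :: "'a \<Rightarrow> 'a"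
  assumes K: "is_subring K" and h: "hom_on K h" and const: "\<And>n::int. h (of_int n) = of_int n"
    and x: "x \<in> K" "algebraic_int x"
  shows "algebraic_int (h x)"
proof -
  obtain P :: "int poly" where P: "poly (map_poly of_int P) x = 0" "lead_coeff P = 1"
    using x(2) by (auto simp: algebraic_int_altdef_ipoly)
  have pow: "h (x ^ i) = h x ^ i" for i
    using x(1) by (induction i) (auto simp: hom_on_1[OF h] hom_on_mult[OF h] subring_power[OF K])
  have "h (\<Sum>i\<le>degree P. of_int (coeff P i) * x ^ i) = (\<Sum>i\<le>degree P. h (of_int (coeff P i) * x ^ i))"
    by (intro hom_on_sum[OF K h] subring_mult[OF K] subring_of_int[OF K] subring_power[OF K] x)
  also have "\<dots> = (\<Sum>i\<le>degree P. of_int (coeff P i) * h x ^ i)"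
    by (simp add: hom_on_mult[OF h subring_of_int[OF K] subring_power[OF K x(1)]] const pow)
  finally have "poly (map_poly of_int P) (h x) = h (poly (map_poly of_int P) x)"
    by (simp add: poly_altdef)
  hence "poly (map_poly of_int P) (h x) = 0" using P(1) hom_on_0[OF h] by simp
  thus ?thesis using P(2) by (auto simp: algebraic_int_altdef_ipoly)
qed

text \<open>Finiteness of the group is a separate assumption; the theorem reads it off from the
  isomorphism with \<open>C_l \<times> C_l\<close>.\<close>

locale rational_galois_extension =
  fixes K :: "'a::field_char_0 set"
  assumes galois: "finite_galois_extension K \<rat>"
    and finite_group: "finite (carrier (galois_group K \<rat>))"
begin

abbreviation "Gal \<equiv> carrier (galois_group K \<rat>)"

abbreviation "gmult \<equiv> monoid.mult (galois_group K \<rat>)"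

definition "gone = (\<lambda>x\<in>K. x)"

definition "ints = {x \<in> K. algebraic_int x}"

lemma subring_K: "is_subring K"
  using galois by (auto simp: finite_galois_extension_def intro: is_subring_subfield)

lemma subring_ints: "is_subring ints"
  unfolding ints_def by (rule is_subring_algebraic_ints[OF subring_K])

lemma Gal_iff:
  "\<sigma> \<in> Gal \<longleftrightarrow> \<sigma> \<in> Bij K \<and> \<sigma> 1 = 1 \<and> (\<forall>x\<in>\<rat>. \<sigma> x = x) \<and>
    (\<forall>x\<in>K. \<sigma> x \<in> K) \<and> (\<forall>x\<in>K. \<forall>y\<in>K. \<sigma> (x + y) = \<sigma> x + \<sigma> y \<and> \<sigma> (x * y) = \<sigma> x * \<sigma> y)"
  by (auto simp: galois_group_def Ring.ring_hom_def)

lemma Rats_subset: "\<rat> \<subseteq> K"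
  using galois by (simp add: finite_galois_extension_def)

lemma gmult_apply: "\<sigma> \<in> Gal \<Longrightarrow> \<tau> \<in> Gal \<Longrightarrow> gmult \<sigma> \<tau> = compose K \<sigma> \<tau>"
  by (simp add: galois_group_def BijGroup_def)

lemma gmult_closed:
  assumes "\<sigma> \<in> Gal" "\<tau> \<in> Gal"
  shows "gmult \<sigma> \<tau> \<in> Gal"
  using assms Rats_subset subring_one[OF subring_K] subring_add[OF subring_K] subring_mult[OF subring_K]
  unfolding gmult_apply[OF assms] Gal_iff
  by (auto simp: compose_Bij compose_eq)

lemma gone_in_Gal: "gone \<in> Gal"
  using Rats_subset subring_one[OF subring_K] subring_add[OF subring_K] subring_mult[OF subring_K]
  by (auto simp: Gal_iff gone_def id_Bij)

lemma hom_on_Gal: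
  assumes "\<sigma> \<in> Gal"
  shows "hom_on K \<sigma>"
  using assms by (auto simp: hom_on_def Gal_iff)

lemma inj_gmult:
  assumes \<sigma>: "\<sigma> \<in> Gal"
  shows "inj_on (gmult \<sigma>) Gal"
proof (rule inj_onI)
  fix \<tau> \<rho> assume \<tau>: "\<tau> \<in> Gal" and \<rho>: "\<rho> \<in> Gal" and eq: "gmult \<sigma> \<tau> = gmult \<sigma> \<rho>"
  have ext: "\<tau> \<in> extensional K" "\<rho> \<in> extensional K" and inj: "inj_on \<sigma> K"
    using \<sigma> \<tau> \<rho> by (auto simp: Gal_iff Bij_def bij_betw_def)
  show "\<tau> = \<rho>"
  proof (rule extensionalityI[OF ext])
    fix x assume x: "x \<in> K"
    have "\<sigma> (\<tau> x) = \<sigma> (\<rho> x)"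
      using fun_cong[OF eq, of x] x by (simp add: gmult_apply \<sigma> \<tau> \<rho> compose_eq)
    thus "\<tau> x = \<rho> x" using inj x \<tau> \<rho> by (auto simp: Gal_iff dest: inj_onD)
  qed
qed

sublocale galois_ring ints Gal gmult gone
proof
  show "is_subring ints" by (rule subring_ints)
  show "finite Gal" by (rule finite_group)
  show "hom_on ints \<sigma>" if "\<sigma> \<in> Gal" for \<sigma>
    using hom_on_Gal[OF that] by (auto simp: hom_on_def ints_def)
  show "\<sigma> x \<in> ints" if "\<sigma> \<in> Gal" "x \<in> ints" for \<sigma> x
    using that algebraic_int_hom_on[OF subring_K hom_on_Gal[OF that(1)], of x]
    by (auto simp: ints_def Gal_iff)
  show "bij_betw (gmult \<sigma>) Gal Gal" if "\<sigma> \<in> Gal" for \<sigma>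
    using endo_inj_surj[OF finite_group _ inj_gmult[OF that]] gmult_closed[OF that] inj_gmult[OF that]
    by (auto simp: bij_betw_def)
  show "gmult \<sigma> \<tau> x = \<sigma> (\<tau> x)" if "\<sigma> \<in> Gal" "\<tau> \<in> Gal" "x \<in> ints" for \<sigma> \<tau> x
    using that by (simp add: gmult_apply compose_eq ints_def)
  show "gone \<in> Gal" by (rule gone_in_Gal)
  show "gone x = x" if "x \<in> ints" for x using that by (simp add: gone_def ints_def)
  \<comment> \<open>An invariant is rational by the Galois hypothesis, and a rational algebraic
    integer is an integer.\<close>
  show "x \<in> \<int>" if "x \<in> ints" "\<And>\<sigma>. \<sigma> \<in> Gal \<Longrightarrow> \<sigma> x = x" for x
  proof -
    have "x \<in> {x \<in> K. \<forall>\<sigma>\<in>Gal. \<sigma> x = x}" using that by (simp add: ints_def)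
    hence "x \<in> \<rat>" using galois unfolding finite_galois_extension_def by blast
    thus ?thesis using that(1) rational_algebraic_int_is_int by (auto simp: ints_def)
  qed
qed

lemma funpow_eq_id_if_exponent:
  assumes iso: "h \<in> iso (galois_group K \<rat>) H" and H: "group H"
    and exp: "\<And>y. y \<in> carrier H \<Longrightarrow> y [^]\<^bsub>H\<^esub> (l::nat) = \<one>\<^bsub>H\<^esub>"
    and \<sigma>: "\<sigma> \<in> Gal" and x: "x \<in> K"
  shows "(\<sigma> ^^ l) x = x"
proof -
  interpret H: group H by (rule H)
  have hom: "h (gmult \<tau> \<rho>) = h \<tau> \<otimes>\<^bsub>H\<^esub> h \<rho>" if "\<tau> \<in> Gal" "\<rho> \<in> Gal" for \<tau> \<rho>
    using iso that by (simp add: iso_def hom_def)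
  have closed: "h \<tau> \<in> carrier H" if "\<tau> \<in> Gal" for \<tau>
    using iso that by (auto simp: iso_def hom_def)
  have inj: "inj_on h Gal" using iso by (auto simp: iso_def bij_betw_def)
  \<comment> \<open>The image of \<open>gone\<close> is idempotent in the group \<open>H\<close>, so
    it is the unit.\<close>
  have "gmult gone gone = gone"
    unfolding gmult_apply[OF gone_in_Gal gone_in_Gal] by (auto simp: gone_def compose_def)
  hence h1: "h gone = \<one>\<^bsub>H\<^esub>"
    using hom[OF gone_in_Gal gone_in_Gal] closed[OF gone_in_Gal] by (metis H.l_cancel_one')
  \<comment> \<open>The iterated product is followed in three ways at once: as a member of the
    group, through its image in \<open>H\<close>, and by its action on \<open>x\<close>.\<close>
  have pow: "(gmult \<sigma> ^^ n) gone \<in> Gal \<and> h ((gmult \<sigma> ^^ n) gone) = h \<sigma> [^]\<^bsub>H\<^esub> n \<and>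
      (gmult \<sigma> ^^ n) gone x = (\<sigma> ^^ n) x" for n
  proof (induction n)
    case 0
    have "gone x = x" using x by (simp add: gone_def)
    thus ?case using gone_in_Gal h1 by simp
  next
    case (Suc n)
    have "h \<sigma> [^]\<^bsub>H\<^esub> Suc n = h \<sigma> \<otimes>\<^bsub>H\<^esub> h \<sigma> [^]\<^bsub>H\<^esub> n"
      by (rule H.nat_pow_Suc2[OF closed[OF \<sigma>]])
    with Suc show ?case
      using gmult_closed[OF \<sigma>] hom[OF \<sigma>] gmult_apply[OF \<sigma>] x by (simp add: compose_eq)
  qed
  have "h ((gmult \<sigma> ^^ l) gone) = h gone" using pow exp[OF closed[OF \<sigma>]] h1 by simp
  hence "(gmult \<sigma> ^^ l) gone = gone" using pow gone_in_Gal by (intro inj_onD[OF inj]) auto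
  thus ?thesis using pow[of l] x by (simp add: gone_def)
qed

end

section \<open>Ideals of index \<open>p ^ l\<close> in the ring of integers\<close>

lemma pow_DirProd: "(a, b) [^]\<^bsub>G \<times>\<times> H\<^esub> (n::nat) = (a [^]\<^bsub>G\<^esub> n, b [^]\<^bsub>H\<^esub> n)"
  by (induction n) (simp_all add: nat_pow_def DirProd_def)

lemma (in rational_galois_extension) ideal_of_index_power:
  assumes l: "Factorial_Ring.prime (l::nat)" and p: "Factorial_Ring.prime (p::nat)"
    and fin: "finite_mod ints p"
    and exp: "\<And>\<sigma> x. \<sigma> \<in> Gal \<Longrightarrow> x \<in> ints \<Longrightarrow> (\<sigma> ^^ l) x = x"
  shows "\<exists>I. is_ideal ints I \<and> of_nat (p ^ l) \<in> I \<and> has_index ints I (p ^ l)"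
proof -
  have residue: "card (add_coset ints M ` ints) \<in> {p, p ^ l}"
    and finM: "finite (add_coset ints M ` ints)"
    if M: "is_prime_ideal ints M" "of_nat p \<in> M" for M
  proof -
    show "finite (add_coset ints M ` ints)"
      using M fin by (intro finite_add_cosets[OF subring]) (auto simp: is_prime_ideal_def)
    \<comment> \<open>The lifted Frobenius depends on \<open>x\<close>, but after \<open>l\<close>
      iterations each of them returns to \<open>x\<close>.\<close>
    moreover have "x ^ (p ^ l) - x \<in> M" if "x \<in> ints" for x
      using frobenius_lift_orbit[OF M(1) p M(2) that] exp[OF _ that] by metis
    ultimately show "card (add_coset ints M ` ints) \<in> {p, p ^ l}"
      using card_residue_field[OF subring M(1) p M(2) l] by blast
  qed
  show ?thesis
  proof (cases "\<exists>M. is_prime_ideal ints M \<and> of_nat p \<in> M \<and> card (add_coset ints M ` ints) = p ^ l")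
    case True
    then obtain M where M: "is_prime_ideal ints M" "of_nat p \<in> M"
      "card (add_coset ints M ` ints) = p ^ l" by blast
    have I: "is_ideal ints M" using M(1) by (simp add: is_prime_ideal_def)
    have "has_index ints M (p ^ l)" using has_index_card[OF subring I finM[OF M(1,2)]] M(3) by simp
    moreover have "of_nat (p ^ l) \<in> M"
      using of_nat_index_in_ideal[OF subring I finM[OF M(1,2)]] M(3) by simp
    ultimately show ?thesis using I by blast
  next
    case False
    show ?thesis
    proof (rule ideal_of_prime_power_index[OF subring p fin])
      fix x assume x: "x \<in> ints"
      \<comment> \<open>Otherwise \<open>1 / p\<close> would be a rational algebraic integer, hence
        an integer.\<close>
      show "of_nat p * x \<noteq> 1"
      proof
        assume eq: "of_nat p * x = 1"
        have "p > 1" using p by (rule prime_gt_1_nat)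
        hence "x = 1 / of_nat p" using eq by (simp add: field_simps)
        hence "x \<in> \<rat>" by simp
        hence "x \<in> \<int>" using x rational_algebraic_int_is_int by (auto simp: ints_def)
        then obtain k where "x = of_int k" by (auto elim: Ints_cases)
        hence "of_int (int p * k) = (of_int 1 :: 'a)" using eq by simp
        hence "int p * k = 1" by (simp only: of_int_eq_iff)
        thus False using \<open>p > 1\<close> by (simp add: zmult_eq_1_iff)
      qed
    next
      fix M assume M: "is_prime_ideal ints M" "of_nat p \<in> M"
      have I: "is_ideal ints M" using M(1) by (simp add: is_prime_ideal_def)
      have "card (add_coset ints M ` ints) = p" using residue[OF M] False M by blast
      thus "has_index ints M p" using has_index_card[OF subring I finM[OF M]] by simp
    qed
  qed
qed

theorem theorem3p1:
  fixes K :: "'a::field_char_0 set" and l :: nat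
  assumes "Factorial_Ring.prime l"
    and "number_field K"
    and "finite_galois_extension K \<rat>"
    and "galois_group K \<rat> \<cong> integer_mod_group l \<times>\<times> integer_mod_group l"
  shows "\<forall>p::nat. Factorial_Ring.prime p \<longrightarrow> dedekind_coeff K (p ^ l) \<noteq> 0"
proof (intro allI impI)
  fix p :: nat assume p: "Factorial_Ring.prime p"
  let ?H = "integer_mod_group l \<times>\<times> integer_mod_group l"
  have l0: "l > 0" using assms(1) by (rule prime_gt_0_nat)
  obtain h where h: "h \<in> iso (galois_group K \<rat>) ?H" using assms(4) by (auto simp: is_iso_def)
  have finH: "finite (carrier ?H)" using l0 by (simp add: carrier_integer_mod_group)
  have "finite (carrier (galois_group K \<rat>))"
    using h finH bij_betw_finite by (auto simp: iso_def)
  then interpret rational_galois_extension K using assms(3) by unfold_locales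
  have exp: "(\<sigma> ^^ l) x = x" if "\<sigma> \<in> Gal" "x \<in> ints" for \<sigma> x
  proof (rule funpow_eq_id_if_exponent[OF h _ _ that(1)])
    show "group ?H" by (intro DirProd_group group_integer_mod_group)
    show "y [^]\<^bsub>?H\<^esub> l = \<one>\<^bsub>?H\<^esub>" for y by (cases y) (simp add: pow_DirProd)
    show "x \<in> K" using that(2) by (simp add: ints_def)
  qed
  obtain B where "finite B" "K \<subseteq> rat_space.span B"
    using finite_dimension_imp_finite_span[of K] assms(2) by (auto simp: number_field_def)
  hence fin: "finite_mod ints q" if "Factorial_Ring.prime q" for q
    using that by (intro finite_mod_prime[OF subring, of B]) (auto simp: ints_def)
  let ?A = "{I. ideal I (ring_of_integers K) \<and> I \<noteq> {0} \<and>
    card (a_rcosets\<^bsub>ring_of_integers K\<^esub> I) = p ^ l}"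
  have R: "ring_of_integers K = ring_on ints" by (simp add: ring_of_integers_def ints_def)
  have pl: "p ^ l \<noteq> 0" using p by auto
  obtain I where I: "is_ideal ints I" "of_nat (p ^ l) \<in> I" "has_index ints I (p ^ l)"
    using ideal_of_index_power[OF assms(1) p fin[OF p] exp] by blast
  have "(of_nat (p ^ l) :: 'a) \<noteq> 0" using pl by (simp only: of_nat_eq_0_iff not_False_eq_True)
  hence "I \<in> ?A"
    using I card_add_cosets(2)[OF subring I(1,3)] a_rcosets_ring_on[OF subring I(1)]
    by (auto simp: R ideal_ring_on_iff[OF subring])
  \<comment> \<open>The coefficient is a \<open>card\<close>, which is 0 on infinite sets, so
    finiteness of \<open>?A\<close> has to accompany the witness \<open>I\<close>. Since
    \<open>p ^ l\<close> is nonzero, the index condition itself makes the set of cosets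
    finite.\<close>
  moreover have "?A \<subseteq> {I. is_ideal ints I \<and> of_nat (p ^ l) \<in> I}"
  proof
    fix J assume "J \<in> ?A"
    hence J: "is_ideal ints J" "card (add_coset ints J ` ints) = p ^ l"
      using a_rcosets_ring_on[OF subring, of J] by (auto simp: R ideal_ring_on_iff[OF subring])
    hence "finite (add_coset ints J ` ints)" using pl card_ge_0_finite by (metis neq0_conv)
    thus "J \<in> {I. is_ideal ints I \<and> of_nat (p ^ l) \<in> I}"
      using of_nat_index_in_ideal[OF subring J(1)] J by simp
  qed
  hence "finite ?A"
    using finite_ideals_containing[OF subring finite_mod_power[OF subring fin[OF p]]] finite_subset
    by blast
  ultimately show "dedekind_coeff K (p ^ l) \<noteq> 0"
    unfolding dedekind_coeff_def by (metis (no_types, lifting) card_0_eq empty_iff)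
qed

end
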